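(* Let $X$ be a topological linear space with $H^2\subset X\subset\mathrm{Hol}(\mathbb{D})$, where the inclusions are continuous, and let $X^*\subset H^2$ be the Cauchy dual of $X$. If $\mathcal{N}$ is dense in $X$, then $$\mathcal{N}^\perp\cap X^*=\{0\}.$$ The converse holds when $X$ is a Fréchet space: if $X$ is Fréchet and $\mathcal{N}^\perp\cap X^*=\{0\}$, then $\mathcal{N}$ is dense in $X$.
   Context: $\mathrm{Hol}(\mathbb{D})$ is the space of holomorphic functions on the unit disk $\mathbb{D}$ with the topology of locally uniform convergence; $H^2$ is the Hardy-Hilbert space. Cauchy dual: let $X$ be a complete metrizable linear subspace of $\mathrm{Hol}(\mathbb{D})$. A linear space $X^*\subset \mathrm{Hol}(\mathbb{D})$ is called the Cauchy dual of $X$ if the continuous linear functionals on $X$ are exactly those represented by the Cauchy pairing $f\mapsto\langle f,g\rangle$ with $g\in X^*$, where $$\langle f,g\rangle:=\lim_{r\to1^-}\int_{\mathbb{T}}f(r\zeta)\overline{g(r\zeta)}\,dm(\zeta),\quad f\in X,\ g\in X^*,$$ and $m$ is normalized Lebesgue measure on the unit circle $\mathbb{T}$. If $H^2\subset X$ then $X^*\subset H^2$, and for $f,g\in H^2$ the pairing is the $H^2$ inner product. (When speaking of the Cauchy dual of $X$ it is understood that $X$ is such a space and has a Cauchy dual.) Fréchet spaces are locally convex. For $k\ge2$, $$h_k(z)=\frac{1}{1-z}\log\left(\frac{1+z+\dots+z^{k-1}}{k}\right),\quad z\in\mathbb{D},$$ with the holomorphic branch of the logarithm on $\mathbb{D}$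 equal to $-\log k\in\mathbb{R}$ at $z=0$; each $h_k$ is known to belong to $H^2$. $\mathcal{N}$ is the linear span of $\{h_k:k\ge2\}$, and $\mathcal{N}^\perp$ is its orthogonal complement in $H^2$. *)

theory Defs
  imports "HOL-Complex_Analysis.Complex_Analysis" "HOL-Library.Function_Algebras"
begin

text \<open>Holomorphic functions on the unit disc are represented by total functions that vanish
  outside the disc, so that equality on the disc is equality of functions and the pointwise
  operations make \<open>hol_disc\<close> a complex vector space.\<close>

definition fscale :: "complex \<Rightarrow> (complex \<Rightarrow> complex) \<Rightarrow> (complex \<Rightarrow> complex)" where
  "fscale c f = (\<lambda>z. c * f z)"

interpretation fun_space: vector_space fscale
  by unfold_locales (auto simp: fscale_def fun_eq_iff algebra_simps)

definition hol_disc :: "(complex \<Rightarrow> complex) set" where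
  "hol_disc = {f. f holomorphic_on ball 0 1 \<and> (\<forall>z. z \<notin> ball 0 1 \<longrightarrow> f z = 0)}"

subsection \<open>Locally uniform convergence\<close>

definition hol_open :: "(complex \<Rightarrow> complex) set \<Rightarrow> bool" where
  "hol_open U \<longleftrightarrow> U \<subseteq> hol_disc \<and>
     (\<forall>f\<in>U. \<exists>K e. compact K \<and> K \<subseteq> ball 0 1 \<and> 0 < e \<and>
        {g \<in> hol_disc. \<forall>z\<in>K. cmod (g z - f z) < e} \<subseteq> U)"

definition hol_topology :: "(complex \<Rightarrow> complex) topology" where
  "hol_topology = topology hol_open"

lemma istopology_hol_open: "istopology hol_open"
proof -
  have "hol_open (S \<inter> T)" if S: "hol_open S" and T: "hol_open T" for S T
    unfolding hol_open_def
  proof (intro conjI ballI)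
    show "S \<inter> T \<subseteq> hol_disc" using S by (auto simp: hol_open_def)
  next
    fix f assume f: "f \<in> S \<inter> T"
    obtain K e where K: "compact K" "K \<subseteq> ball 0 1" "0 < e"
        "{g \<in> hol_disc. \<forall>z\<in>K. cmod (g z - f z) < e} \<subseteq> S"
      using S f unfolding hol_open_def by blast
    obtain L d where L: "compact L" "L \<subseteq> ball 0 1" "0 < d"
        "{g \<in> hol_disc. \<forall>z\<in>L. cmod (g z - f z) < d} \<subseteq> T"
      using T f unfolding hol_open_def by blast
    have "{g \<in> hol_disc. \<forall>z\<in>K \<union> L. cmod (g z - f z) < min e d} \<subseteq> S \<inter> T"
    proof
      fix g assume g: "g \<in> {g \<in> hol_disc. \<forall>z\<in>K \<union> L. cmod (g z - f z) < min e d}"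
      then have "g \<in> {g \<in> hol_disc. \<forall>z\<in>K. cmod (g z - f z) < e}"
        and "g \<in> {g \<in> hol_disc. \<forall>z\<in>L. cmod (g z - f z) < d}"
        by auto
      then show "g \<in> S \<inter> T" using K(4) L(4) by blast
    qed
    moreover have "compact (K \<union> L)" "K \<union> L \<subseteq> ball 0 1" "0 < min e d"
      using K L by (auto simp: compact_Un)
    ultimately show "\<exists>K e. compact K \<and> K \<subseteq> ball 0 1 \<and> 0 < e \<and>
        {g \<in> hol_disc. \<forall>z\<in>K. cmod (g z - f z) < e} \<subseteq> S \<inter> T"
      by blast
  qed
  moreover have "hol_open (\<Union>\<K>)" if \<K>: "\<forall>S\<in>\<K>. hol_open S" for \<K>
    unfolding hol_open_def
  proof (intro conjI ballI)
    show "\<Union>\<K> \<subseteq> hol_disc" using \<K> by (auto simp: hol_open_def)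
  next
    fix f assume "f \<in> \<Union>\<K>"
    then obtain S where S: "S \<in> \<K>" "f \<in> S" by blast
    then obtain K e where "compact K" "K \<subseteq> ball 0 1" "0 < e"
        "{g \<in> hol_disc. \<forall>z\<in>K. cmod (g z - f z) < e} \<subseteq> S"
      using S bspec[OF \<K> S(1)] unfolding hol_open_def by blast
    then show "\<exists>K e. compact K \<and> K \<subseteq> ball 0 1 \<and> 0 < e \<and>
        {g \<in> hol_disc. \<forall>z\<in>K. cmod (g z - f z) < e} \<subseteq> \<Union>\<K>"
      using S by blast
  qed
  ultimately show ?thesis by (simp add: istopology_def)
qed

lemma openin_hol_topology: "openin hol_topology = hol_open"
  by (simp add: hol_topology_def istopology_hol_open)

lemma topspace_hol_topology: "topspace hol_topology = hol_disc"
proof -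
  have "hol_open hol_disc"
    unfolding hol_open_def by (auto intro!: exI[of _ "{}"] exI[of _ "1::real"])
  then show ?thesis
    using openin_subset[of hol_topology hol_disc] hol_open_def openin_topspace[of hol_topology]
    by (simp add: openin_hol_topology subset_antisym)
qed

subsection \<open>The Hardy--Hilbert space\<close>

definition taylor_coeff :: "(complex \<Rightarrow> complex) \<Rightarrow> nat \<Rightarrow> complex" where
  "taylor_coeff f n = (deriv ^^ n) f 0 / fact n"

definition hardy2 :: "(complex \<Rightarrow> complex) set" where
  "hardy2 = {f \<in> hol_disc. summable (\<lambda>n. (cmod (taylor_coeff f n))\<^sup>2)}"

definition hardy2_inner :: "(complex \<Rightarrow> complex) \<Rightarrow> (complex \<Rightarrow> complex) \<Rightarrow> complex" where
  "hardy2_inner f g = (\<Sum>n. taylor_coeff f n * cnj (taylor_coeff g n))"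

definition hardy2_norm :: "(complex \<Rightarrow> complex) \<Rightarrow> real" where
  "hardy2_norm f = sqrt (\<Sum>n. (cmod (taylor_coeff f n))\<^sup>2)"

text \<open>The guard matters only because the locale \<open>Metric_space\<close> asks for nonnegativity and
  symmetry on the whole type.\<close>

definition hardy2_dist :: "(complex \<Rightarrow> complex) \<Rightarrow> (complex \<Rightarrow> complex) \<Rightarrow> real" where
  "hardy2_dist f g = (if f \<in> hardy2 \<and> g \<in> hardy2 then hardy2_norm (f - g) else 0)"

definition hardy2_topology :: "(complex \<Rightarrow> complex) topology" where
  "hardy2_topology = Metric_space.mtopology hardy2 hardy2_dist"

lemma hol_disc_diff: "f \<in> hol_disc \<Longrightarrow> g \<in> hol_disc \<Longrightarrow> f - g \<in> hol_disc"
  by (auto simp: hol_disc_def fun_diff_def intro!: holomorphic_on_diff)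

lemma taylor_coeff_diff:
  assumes "f \<in> hol_disc" "g \<in> hol_disc"
  shows "taylor_coeff (f - g) n = taylor_coeff f n - taylor_coeff g n"
proof -
  have "(deriv ^^ n) (\<lambda>w. f w - g w) 0 = (deriv ^^ n) f 0 - (deriv ^^ n) g 0"
    using assms by (intro higher_deriv_diff[where S = "ball 0 1"]) (auto simp: hol_disc_def)
  then show ?thesis by (simp add: taylor_coeff_def fun_diff_def diff_divide_distrib)
qed

lemma taylor_coeff_sums:
  assumes "f \<in> hol_disc" "z \<in> ball 0 1"
  shows "(\<lambda>n. taylor_coeff f n * z ^ n) sums f z"
  using holomorphic_power_series[of f 0 1 z] assms by (simp add: hol_disc_def taylor_coeff_def)

lemma l2_triangle:
  fixes a b :: "nat \<Rightarrow> complex"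
  assumes a: "summable (\<lambda>n. (cmod (a n))\<^sup>2)" and b: "summable (\<lambda>n. (cmod (b n))\<^sup>2)"
  shows "summable (\<lambda>n. (cmod (a n + b n))\<^sup>2)"
    and "sqrt (\<Sum>n. (cmod (a n + b n))\<^sup>2)
           \<le> sqrt (\<Sum>n. (cmod (a n))\<^sup>2) + sqrt (\<Sum>n. (cmod (b n))\<^sup>2)"
proof -
  let ?R = "sqrt (\<Sum>n. (cmod (a n))\<^sup>2) + sqrt (\<Sum>n. (cmod (b n))\<^sup>2)"
  have R: "0 \<le> ?R" using a b by (simp add: suminf_nonneg)
  have part: "(\<Sum>n<N. (cmod (a n + b n))\<^sup>2) \<le> ?R\<^sup>2" for N
  proof -
    have "sqrt (\<Sum>n<N. (cmod (a n + b n))\<^sup>2) \<le> L2_set (\<lambda>n. cmod (a n) + cmod (b n)) {..<N}"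
      unfolding L2_set_def
      by (intro real_sqrt_le_mono sum_mono power_mono norm_triangle_ineq) auto
    also have "\<dots> \<le> L2_set (\<lambda>n. cmod (a n)) {..<N} + L2_set (\<lambda>n. cmod (b n)) {..<N}"
      by (rule L2_set_triangle_ineq)
    also have "\<dots> \<le> ?R"
      unfolding L2_set_def
      by (intro add_mono real_sqrt_le_mono sum_le_suminf a b) auto
    finally show ?thesis using R by (simp add: sqrt_le_D)
  qed
  show s: "summable (\<lambda>n. (cmod (a n + b n))\<^sup>2)"
    by (rule bounded_imp_summable[where B = "?R\<^sup>2"]) (use part[of "Suc _"] in
        \<open>auto simp: lessThan_Suc_atMost\<close>)
  have "(\<Sum>n. (cmod (a n + b n))\<^sup>2) \<le> ?R\<^sup>2"
    using s part by (rule suminf_le_const)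
  then show "sqrt (\<Sum>n. (cmod (a n + b n))\<^sup>2) \<le> ?R"
    using R by (simp add: real_le_lsqrt suminf_nonneg s)
qed

lemma hardy2_diff:
  assumes "f \<in> hardy2" "g \<in> hardy2" shows "f - g \<in> hardy2"
  using assms l2_triangle(1)[of "taylor_coeff f" "\<lambda>n. - taylor_coeff g n"]
  by (auto simp: hardy2_def hol_disc_diff taylor_coeff_diff)

lemma hardy2_norm_nonneg: "f \<in> hardy2 \<Longrightarrow> 0 \<le> hardy2_norm f"
  by (simp add: hardy2_norm_def hardy2_def suminf_nonneg)

lemma Metric_space_hardy2: "Metric_space hardy2 hardy2_dist"
proof
  show "0 \<le> hardy2_dist f g" for f g
    by (simp add: hardy2_dist_def hardy2_norm_nonneg hardy2_diff)
  show "hardy2_dist f g = hardy2_dist g f" for f g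
    by (auto simp: hardy2_dist_def hardy2_norm_def hardy2_def taylor_coeff_diff norm_minus_commute)
  show "hardy2_dist f g = 0 \<longleftrightarrow> f = g" if fg: "f \<in> hardy2" "g \<in> hardy2" for f g
  proof
    have hol: "f \<in> hol_disc" "g \<in> hol_disc" using fg by (auto simp: hardy2_def)
    assume "hardy2_dist f g = 0"
    then have "(\<Sum>n. (cmod (taylor_coeff (f - g) n))\<^sup>2) = 0"
      using fg by (simp add: hardy2_dist_def hardy2_norm_def)
    moreover have "summable (\<lambda>n. (cmod (taylor_coeff (f - g) n))\<^sup>2)"
      using hardy2_diff[OF fg] by (simp add: hardy2_def)
    ultimately have "taylor_coeff (f - g) n = 0" for n
      using suminf_eq_zero_iff[of "\<lambda>n. (cmod (taylor_coeff (f - g) n))\<^sup>2"] by simp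
    then have eq: "taylor_coeff f n = taylor_coeff g n" for n
      using taylor_coeff_diff[OF hol] by simp
    show "f = g"
    proof
      fix z show "f z = g z"
      proof (cases "z \<in> ball 0 1")
        case True
        then show ?thesis
          using taylor_coeff_sums[OF hol(1) True] taylor_coeff_sums[OF hol(2) True] eq
          by (simp add: sums_unique2)
      next
        case False
        then show ?thesis using hol by (auto simp: hol_disc_def)
      qed
    qed
  next
    assume "f = g"
    then show "hardy2_dist f g = 0"
      using fg taylor_coeff_diff[of f f]
      by (auto simp: hardy2_dist_def hardy2_norm_def hardy2_def)
  qed
  show "hardy2_dist f h \<le> hardy2_dist f g + hardy2_dist g h"
    if "f \<in> hardy2" "g \<in> hardy2" "h \<in> hardy2" for f g h
    using l2_triangle(2)[of "taylor_coeff (f - g)" "taylor_coeff (g - h)"]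
      that hardy2_diff[of f g] hardy2_diff[of g h]
    by (auto simp: hardy2_dist_def hardy2_norm_def hardy2_def taylor_coeff_diff)
qed

subsection \<open>Topological linear spaces of functions\<close>

definition topological_linear_space :: "(complex \<Rightarrow> complex) topology \<Rightarrow> bool" where
  "topological_linear_space X \<longleftrightarrow>
     fun_space.subspace (topspace X) \<and>
     continuous_map (prod_topology X X) X (\<lambda>(f, g). f + g) \<and>
     continuous_map (prod_topology euclidean X) X (\<lambda>(c, f). fscale c f)"

definition complete_metrizable_linear_space :: "(complex \<Rightarrow> complex) topology \<Rightarrow> bool" where
  "complete_metrizable_linear_space X \<longleftrightarrow>
     topological_linear_space X \<and>
     (\<exists>d. Metric_space (topspace X) d \<and>
          Metric_space.mtopology (topspace X) d = X \<and>
          Metric_space.mcomplete (topspace X) d \<and>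
          (\<forall>f\<in>topspace X. \<forall>g\<in>topspace X. \<forall>h\<in>topspace X. d (f + h) (g + h) = d f g))"

definition convex_functions :: "(complex \<Rightarrow> complex) set \<Rightarrow> bool" where
  "convex_functions V \<longleftrightarrow>
     (\<forall>f\<in>V. \<forall>g\<in>V. \<forall>t\<in>{0..1}.
        fscale (of_real (1 - t)) f + fscale (of_real t) g \<in> V)"

definition locally_convex :: "(complex \<Rightarrow> complex) topology \<Rightarrow> bool" where
  "locally_convex X \<longleftrightarrow>
     (\<forall>U. openin X U \<and> 0 \<in> U \<longrightarrow>
        (\<exists>V. openin X V \<and> 0 \<in> V \<and> V \<subseteq> U \<and> convex_functions V))"

definition frechet_space :: "(complex \<Rightarrow> complex) topology \<Rightarrow> bool" where
  "frechet_space X \<longleftrightarrow> complete_metrizable_linear_space X \<and> locally_convex X"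

text \<open>Functionals are total functions; only their values on the space matter.\<close>

definition continuous_linear_functional ::
    "(complex \<Rightarrow> complex) topology \<Rightarrow> ((complex \<Rightarrow> complex) \<Rightarrow> complex) \<Rightarrow> bool" where
  "continuous_linear_functional X \<phi> \<longleftrightarrow>
     (\<forall>f\<in>topspace X. \<forall>g\<in>topspace X. \<phi> (f + g) = \<phi> f + \<phi> g) \<and>
     (\<forall>c. \<forall>f\<in>topspace X. \<phi> (fscale c f) = c * \<phi> f) \<and>
     continuous_map X euclidean \<phi>"

subsection \<open>Cauchy duality\<close>

definition circle_mean :: "(complex \<Rightarrow> complex) \<Rightarrow> complex" where
  "circle_mean F = integral {0..2 * pi} (\<lambda>t. F (cis t)) / (2 * pi)"

text \<open>\<open>has_cauchy_pairing f g c\<close>: the limit defining the Cauchy pairing of \<open>f\<close> and \<open>g\<close> exists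
  and equals \<open>c\<close>.\<close>

definition has_cauchy_pairing ::
    "(complex \<Rightarrow> complex) \<Rightarrow> (complex \<Rightarrow> complex) \<Rightarrow> complex \<Rightarrow> bool" where
  "has_cauchy_pairing f g c \<longleftrightarrow>
     ((\<lambda>r. circle_mean (\<lambda>\<zeta>. f (of_real r * \<zeta>) * cnj (g (of_real r * \<zeta>)))) \<longlongrightarrow> c) (at_left 1)"

definition cauchy_dual ::
    "(complex \<Rightarrow> complex) topology \<Rightarrow> (complex \<Rightarrow> complex) set \<Rightarrow> bool" where
  "cauchy_dual X Y \<longleftrightarrow>
     complete_metrizable_linear_space X \<and> topspace X \<subseteq> hol_disc \<and>
     Y \<subseteq> hol_disc \<and> fun_space.subspace Y \<and>
     (\<forall>f\<in>topspace X. \<forall>g\<in>Y. \<exists>c. has_cauchy_pairing f g c) \<and>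
     (\<forall>\<phi>. continuous_linear_functional X \<phi> \<longleftrightarrow>
        (\<exists>g\<in>Y. \<forall>f\<in>topspace X. has_cauchy_pairing f g (\<phi> f)))"

subsection \<open>The functions \<open>h\<^sub>k\<close>\<close>

text \<open>The principal logarithm supplies the required branch: on the disc its argument avoids
  the nonpositive reals, and its value at the origin is real.\<close>

definition h_fun :: "nat \<Rightarrow> complex \<Rightarrow> complex" where
  "h_fun k z = (if z \<in> ball 0 1 then Ln ((\<Sum>i<k. z ^ i) / of_nat k) / (1 - z) else 0)"

lemma geometric_mean_notin_nonpos:
  assumes "k \<ge> 1" "z \<in> ball 0 1"
  shows "(\<Sum>i<k. z ^ i) / of_nat k \<notin> (\<real>\<^sub>\<le>\<^sub>0 :: complex set)"
proof
  assume "(\<Sum>i<k. z ^ i) / of_nat k \<in> (\<real>\<^sub>\<le>\<^sub>0 :: complex set)"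
  then obtain s where s: "s \<le> 0" "(\<Sum>i<k. z ^ i) / of_nat k = complex_of_real s"
    by (auto elim!: nonpos_Reals_cases)
  then have "(\<Sum>i<k. z ^ i) = complex_of_real (s * real k)"
    using assms by (simp add: field_simps)
  then have "1 - z ^ k = (1 - z) * complex_of_real (s * real k)"
    by (simp add: one_diff_power_eq)
  then have "Re (1 - z ^ k) = (1 - Re z) * (s * real k)"
    by simp
  moreover have "Re z < 1" "Re (z ^ k) < 1"
    using assms complex_Re_le_cmod[of z] complex_Re_le_cmod[of "z ^ k"]
      power_less_one_iff[of "cmod z" k] by (auto simp: norm_power)
  ultimately show False
    using s(1) mult_nonneg_nonpos[of "1 - Re z" "s * real k"]
    by (simp add: mult_nonpos_nonneg)
qed

lemma h_fun_log_branch: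
  assumes "k \<ge> 1"
  shows "(\<lambda>z. Ln ((\<Sum>i<k. z ^ i) / of_nat k)) holomorphic_on ball 0 1"
    and "Ln ((\<Sum>i<k. 0 ^ i) / of_nat k) = - complex_of_real (ln (real k))"
proof -
  show "(\<lambda>z. Ln ((\<Sum>i<k. z ^ i) / of_nat k)) holomorphic_on ball 0 1"
    using assms geometric_mean_notin_nonpos by (auto intro!: holomorphic_intros)
  have "(\<Sum>i<k. 0 ^ i) = (1 :: complex)"
    using assms by (simp add: power_0_left)
  then show "Ln ((\<Sum>i<k. 0 ^ i) / of_nat k) = - complex_of_real (ln (real k))"
    using assms Ln_of_real[of "1 / real k"] by (simp add: ln_div)
qed

definition N_space :: "(complex \<Rightarrow> complex) set" where
  "N_space = fun_space.span {h_fun k | k. k \<ge> 2}"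

definition N_perp :: "(complex \<Rightarrow> complex) set" where
  "N_perp = {g \<in> hardy2. \<forall>f\<in>N_space. hardy2_inner f g = 0}"

end

theory Submission
  imports Defs
begin

text \<open>The Cauchy pairing turns density into a statement about annihilators. A continuous linear
  functional \<open>\<phi>\<close> on \<open>X\<close> is the pairing with some \<open>g \<in> X\<^sup>*\<close>. Its value at the monomial \<open>z\<^sup>n\<close>
  is the conjugate of the \<open>n\<close>-th Taylor coefficient of \<open>g\<close>, by Cauchy's integral formula
  (\<open>cauchy_pairing_monomial\<close>). Since \<open>H\<^sup>2\<close> embeds continuously in \<open>X\<close>, \<open>\<phi>\<close> is bounded on \<open>H\<^sup>2\<close>;
  testing it on polynomials shows that its values at the monomials are square summable, and
  approximating by Taylor polynomials that they determine \<open>\<phi>\<close> on \<open>H\<^sup>2\<close>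
  (\<open>hardy2_functional_coefficients\<close>). Hence \<open>g \<in> H\<^sup>2\<close> and \<open>\<phi>\<close> is the inner product with \<open>g\<close> there
  (\<open>cauchy_dual_representation\<close>), so that \<open>\<phi>\<close> vanishes on \<open>\<N>\<close> exactly when \<open>g \<in> \<N>\<^sup>\<bottom>\<close>.

  If \<open>\<N>\<close> is dense, then a functional that vanishes on it is zero, and its values at the
  monomials show that \<open>g = 0\<close>. If \<open>\<N>\<close> is not dense and \<open>X\<close> is locally convex, then the
  Hahn--Banach theorem gives a nonzero functional that vanishes on \<open>\<N>\<close>, hence a nonzero
  \<open>g \<in> \<N>\<^sup>\<bottom> \<inter> X\<^sup>*\<close>.

  Both directions use \<open>\<N> \<subseteq> H\<^sup>2\<close>. The \<open>n\<close>-th Taylor coefficient of \<open>h\<^sub>k\<close> is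
  \<open>H\<^sub>n - H\<^sub>m - log k\<close> with \<open>m = \<lfloor>n/k\<rfloor>\<close> and harmonic numbers \<open>H\<^sub>n\<close>, and comparing harmonic numbers
  with logarithms shows that it is \<open>O(1/n)\<close> (\<open>h_coeff_bound\<close>).\<close>

section \<open>The Hahn--Banach theorem for real sublinear functionals\<close>

text \<open>The Hahn--Banach theorem is needed on the space of functions underlying a topology, which is
  a set and not a type, and its scalars must be restricted from complex to real; hence a locale
  with explicit scalar multiplication and carrier.\<close>

locale real_vector_subspace = vector_space scale
  for scale :: "real \<Rightarrow> 'b::ab_group_add \<Rightarrow> 'b" +
  fixes S :: "'b set"
  assumes subspace_S: "subspace S"
begin

definition sublinear :: "('b \<Rightarrow> real) \<Rightarrow> bool" where
  "sublinear q \<longleftrightarrow> (\<forall>x\<in>S. \<forall>y\<in>S. q (x + y) \<le> q x + q y) \<and>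
     (\<forall>x\<in>S. \<forall>t\<ge>0. q (scale t x) = t * q x)"

text \<open>On \<open>S\<close>, the largest sublinear functional below \<open>q\<close> that is linear on the line through
  \<open>y\<close> and agrees with \<open>q\<close> at \<open>y\<close>: subtracting the slope \<open>q y\<close> while
  moving far out in direction \<open>y\<close> removes the excess of \<open>q\<close> in that direction.\<close>

definition flatten_along :: "'b \<Rightarrow> ('b \<Rightarrow> real) \<Rightarrow> 'b \<Rightarrow> real" where
  "flatten_along y q x = (if x \<in> S then INF t\<in>{0..}. q (x + scale t y) - t * q y else 0)"

lemmas S_closed = subspace_add[OF subspace_S] subspace_scale[OF subspace_S]
  subspace_0[OF subspace_S] subspace_neg[OF subspace_S] subspace_diff[OF subspace_S]

lemma sublinear_add: "sublinear q \<Longrightarrow> x \<in> S \<Longrightarrow> y \<in> S \<Longrightarrow> q (x + y) \<le> q x + q y"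
  and sublinear_scale: "sublinear q \<Longrightarrow> x \<in> S \<Longrightarrow> 0 \<le> t \<Longrightarrow> q (scale t x) = t * q x"
  by (auto simp: sublinear_def)

lemma sublinear_zero: "sublinear q \<Longrightarrow> q 0 = 0"
  using sublinear_scale[of q 0 0] by (simp add: S_closed)

lemma sublinear_neg_lower: 
  assumes "sublinear q" "x \<in> S" shows "- q (- x) \<le> q x"
  using sublinear_add[OF assms(1), of x "- x"] assms sublinear_zero[OF assms(1)]
  by (simp add: S_closed)

text \<open>The inequality for all positive factors is enough: the reverse inequality for \<open>s\<close> is the
  one for \<open>1 / s\<close>.\<close>

lemma sublinear_homogeneousI:
  assumes zero: "q 0 = 0" and le: "\<And>x s. x \<in> S \<Longrightarrow> 0 < s \<Longrightarrow> q (scale s x) \<le> s * q x"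
    and "x \<in> S" "0 \<le> t"
  shows "q (scale t x) = t * q x"
proof (cases "t = 0")
  case True then show ?thesis by (simp add: zero)
next
  case False
  then have t: "0 < t" using assms by simp
  have "q (scale (1/t) (scale t x)) \<le> (1/t) * q (scale t x)"
    using t assms by (intro le S_closed) auto
  then have "t * q x \<le> q (scale t x)" using t by (simp add: field_simps)
  then show ?thesis using le[OF assms(3) t] by simp
qed

lemma flatten_along_bdd_below:
  assumes q: "sublinear q" and "x \<in> S" "y \<in> S"
  shows "bdd_below ((\<lambda>t. q (x + scale t y) - t * q y) ` {0..})"
proof (rule bdd_belowI2)
  fix t :: real assume t: "t \<in> {0..}"
  have "q (scale t y) \<le> q (x + scale t y) + q (- x)"
    using sublinear_add[OF q, of "x + scale t y" "- x"] assms by (simp add: S_closed)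
  then show "- q (- x) \<le> q (x + scale t y) - t * q y"
    using sublinear_scale[OF q] assms t by simp
qed

lemma flatten_along_le:
  assumes "sublinear q" "x \<in> S" "y \<in> S" "0 \<le> t"
  shows "flatten_along y q x \<le> q (x + scale t y) - t * q y"
  using cINF_lower[OF flatten_along_bdd_below[OF assms(1-3)], of t] assms
  by (simp add: flatten_along_def)

lemma flatten_along_greatest:
  assumes "x \<in> S" "\<And>t. 0 \<le> t \<Longrightarrow> c \<le> q (x + scale t y) - t * q y"
  shows "c \<le> flatten_along y q x"
  using assms by (auto simp: flatten_along_def intro!: cINF_greatest)

lemma flatten_along_sublinear:
  assumes q: "sublinear q" and y: "y \<in> S"
  shows "sublinear (flatten_along y q)"
  unfolding sublinear_def
proof (intro conjI ballI allI impI)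
  let ?p = "flatten_along y q"
  fix x x' assume x: "x \<in> S" "x' \<in> S"
  have "?p (x + x') - (q (x' + scale t' y) - t' * q y) \<le> q (x + scale t y) - t * q y"
    if "0 \<le> t" "0 \<le> t'" for t t'
  proof -
    have "?p (x + x') \<le> q ((x + x') + scale (t + t') y) - (t + t') * q y"
      using that x y q by (intro flatten_along_le S_closed) auto
    moreover have "q ((x + x') + scale (t + t') y) \<le> q (x + scale t y) + q (x' + scale t' y)"
      using sublinear_add[OF q, of "x + scale t y" "x' + scale t' y"] x y
      by (simp add: S_closed algebra_simps scale_left_distrib)
    ultimately show ?thesis by (simp add: algebra_simps)
  qed
  then have "?p (x + x') - (q (x' + scale t' y) - t' * q y) \<le> ?p x" if "0 \<le> t'" for t'
    using that x by (intro flatten_along_greatest) auto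
  then have "?p (x + x') - ?p x \<le> ?p x'"
    using x by (intro flatten_along_greatest) (auto simp: algebra_simps)
  then show "?p (x + x') \<le> ?p x + ?p x'" by simp
next
  let ?p = "flatten_along y q"
  fix x and t :: real assume "x \<in> S" "0 \<le> t"
  moreover have "?p 0 = 0"
    using sublinear_scale[OF q y] by (simp add: flatten_along_def S_closed)
  moreover have "?p (scale s x) \<le> s * ?p x" if x: "x \<in> S" and s: "0 < s" for s x
  proof -
    have "?p (scale s x) / s \<le> q (x + scale t y) - t * q y" if t: "0 \<le> t" for t
    proof -
      have "?p (scale s x) \<le> q (scale s x + scale (s * t) y) - (s * t) * q y"
        using s t x y q by (intro flatten_along_le S_closed) auto
      also have "\<dots> = s * (q (x + scale t y) - t * q y)"
        using sublinear_scale[OF q, of "x + scale t y" s] x y s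
        by (simp add: S_closed algebra_simps scale_right_distrib)
      finally show ?thesis using s by (simp add: field_simps)
    qed
    then have "?p (scale s x) / s \<le> ?p x" using x by (intro flatten_along_greatest)
    then show ?thesis using s by (simp add: field_simps)
  qed
  ultimately show "?p (scale t x) = t * ?p x" by (intro sublinear_homogeneousI)
qed

text \<open>Zorn's lemma applies because the infimum of a chain below \<open>p\<close> is again sublinear; it is
  finite because every sublinear \<open>q \<le> p\<close> satisfies \<open>q x \<ge> - q (- x) \<ge> - p (- x)\<close>.\<close>

lemma minimal_sublinear:
  assumes p: "sublinear p"
  obtains q where "sublinear q" "\<And>x. x \<in> S \<Longrightarrow> q x \<le> p x"
    "\<And>r x. sublinear r \<Longrightarrow> (\<And>x. x \<in> S \<Longrightarrow> r x \<le> q x) \<Longrightarrow> x \<in> S \<Longrightarrow> r x = q x"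
proof -
  (* Prescribing the value 0 off S makes the pointwise order on S antisymmetric. *)
  define A where "A = {q. sublinear q \<and> (\<forall>x\<in>S. q x \<le> p x) \<and> (\<forall>x. x \<notin> S \<longrightarrow> q x = 0)}"
  have "partial_order_on A (relation_of (\<lambda>q r. r \<le> q) A)"
    by (rule partial_order_on_relation_ofI) auto
  moreover have "\<exists>u\<in>A. \<forall>q\<in>C. u \<le> q" if C: "C \<in> Chains (relation_of (\<lambda>q r. r \<le> q) A)" for C
  proof (cases "C = {}")
    case True
    have "(\<lambda>x. if x \<in> S then p x else 0) \<in> A"
      using p by (auto simp: A_def sublinear_def S_closed)
    then show ?thesis using True by blast
  next
    case False
    have CA: "q \<in> A" if "q \<in> C" for q
      using C that by (auto simp: Chains_def relation_of_def)
    have tot: "q \<le> r \<or> r \<le> q" if "q \<in> C" "r \<in> C" for q r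
      using C that by (auto simp: Chains_def relation_of_def)
    have bdd: "bdd_below ((\<lambda>q. q x) ` C)" if x: "x \<in> S" for x
    proof (rule bdd_belowI2)
      fix q assume "q \<in> C"
      then show "- p (- x) \<le> q x"
        using CA[of q] sublinear_neg_lower[of q x] x S_closed(4)[OF x] by (force simp: A_def)
    qed
    define u where "u x = (if x \<in> S then INF q\<in>C. q x else 0)" for x
    have u_le: "u x \<le> q x" if "x \<in> S" "q \<in> C" for x q
      using cINF_lower[OF bdd that(2)] that by (simp add: u_def)
    have u_ge: "c \<le> u x" if "x \<in> S" "\<And>q. q \<in> C \<Longrightarrow> c \<le> q x" for c x
      using that False by (auto simp: u_def intro!: cINF_greatest)
    have "u (x + y) \<le> u x + u y" if xy: "x \<in> S" "y \<in> S" for x y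
    proof -
      have "u (x + y) - q x \<le> r y" if qr: "q \<in> C" "r \<in> C" for q r
      proof -
        (* In a chain two members can be compared, so one of them serves both arguments. *)
        obtain s where s: "s \<in> C" "s \<le> q" "s \<le> r" using tot[OF qr] qr by blast
        have "u (x + y) \<le> s (x + y)" using xy s by (intro u_le S_closed)
        also have "\<dots> \<le> s x + s y" using CA[OF s(1)] xy by (auto simp: A_def sublinear_def)
        also have "\<dots> \<le> q x + r y" using s by (intro add_mono) (auto simp: le_fun_def)
        finally show ?thesis by simp
      qed
      then have "u (x + y) - q x \<le> u y" if "q \<in> C" for q
        using that xy by (intro u_ge)
      then have "u (x + y) - u y \<le> u x"
        using xy by (intro u_ge) (auto simp: algebra_simps)
      then show ?thesis by simp
    qed
    moreover have "u (scale t x) = t * u x" if "x \<in> S" "0 \<le> t" for t x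
    proof (rule sublinear_homogeneousI[OF _ _ that])
      have "(\<lambda>q. q 0) ` C = {0}"
        using CA False sublinear_zero by (auto simp: A_def image_iff)
      then show "u 0 = 0" by (simp add: u_def S_closed)
    next
      fix x and s :: real assume x: "x \<in> S" and s: "0 < s"
      have "u (scale s x) / s \<le> q x" if "q \<in> C" for q
        using u_le[OF S_closed(2)[OF x] that, of s] CA[OF that] x s
        by (auto simp: A_def sublinear_def field_simps)
      then have "u (scale s x) / s \<le> u x" using x by (intro u_ge)
      then show "u (scale s x) \<le> s * u x" using s by (simp add: field_simps)
    qed
    moreover have "u x \<le> p x" if "x \<in> S" for x
    proof -
      obtain q where "q \<in> C" using False by blast
      then show ?thesis using u_le[OF that, of q] CA[of q] that by (force simp: A_def)
    qed
    ultimately have "u \<in> A" by (auto simp: A_def sublinear_def u_def)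
    moreover have "u \<le> q" if "q \<in> C" for q
      unfolding le_fun_def using u_le[OF _ that] CA[OF that] by (auto simp: u_def A_def)
    ultimately show ?thesis by blast
  qed
  ultimately obtain q where q: "q \<in> A" and min: "\<forall>r\<in>A. r \<le> q \<longrightarrow> r = q"
    using predicate_Zorn[of A "\<lambda>q r. r \<le> q"] by blast
  show thesis
  proof
    show "sublinear q" "\<And>x. x \<in> S \<Longrightarrow> q x \<le> p x" using q by (auto simp: A_def)
    fix r x assume r: "sublinear r" "\<And>x. x \<in> S \<Longrightarrow> r x \<le> q x" and x: "x \<in> S"
    let ?r = "\<lambda>x. if x \<in> S then r x else 0"
    have "sublinear ?r" using r(1) by (simp add: sublinear_def S_closed)
    moreover have "?r \<le> q" using r(2) q by (auto simp: le_fun_def A_def)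
    ultimately have "?r \<in> A" using q by (auto simp: A_def le_fun_def intro: order_trans[OF r(2)])
    then have "?r = q" using min \<open>?r \<le> q\<close> by blast
    from fun_cong[OF this, of x] show "r x = q x" using x by simp
  qed
qed

text \<open>A minimal sublinear functional \<open>q\<close> is linear: flattening it along any \<open>y\<close> cannot decrease it,
  so \<open>q x \<le> q (x + y) - q y\<close>, which is the missing half of additivity. Starting from \<open>p\<close>
  flattened along \<open>z\<close>, whose value at \<open>- z\<close> is at most \<open>- p z\<close>, forces \<open>l z \<ge> p z\<close>.\<close>

theorem hahn_banach:
  assumes p: "sublinear p" and z: "z \<in> S"
  obtains l where "\<And>x y. x \<in> S \<Longrightarrow> y \<in> S \<Longrightarrow> l (x + y) = l x + l y"
    "\<And>t x. x \<in> S \<Longrightarrow> l (scale t x) = t * l x"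
    "\<And>x. x \<in> S \<Longrightarrow> l x \<le> p x" "p z \<le> l z"
proof -
  obtain q where q: "sublinear q" "\<And>x. x \<in> S \<Longrightarrow> q x \<le> flatten_along z p x"
    and min: "\<And>r x. sublinear r \<Longrightarrow> (\<And>x. x \<in> S \<Longrightarrow> r x \<le> q x) \<Longrightarrow> x \<in> S \<Longrightarrow> r x = q x"
    by (metis minimal_sublinear[OF flatten_along_sublinear[OF p z]])
  have add: "q (x + y) = q x + q y" if xy: "x \<in> S" "y \<in> S" for x y
  proof -
    have "flatten_along y q v \<le> q v" if "v \<in> S" for v
      using flatten_along_le[OF q(1) that xy(2), of 0] by simp
    then have "flatten_along y q x = q x"
      using min[OF flatten_along_sublinear[OF q(1) xy(2)]] xy by blast
    then have "q x \<le> q (x + y) - q y"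
      using flatten_along_le[OF q(1) xy, of 1] by simp
    then show ?thesis using sublinear_add[OF q(1) xy] by simp
  qed
  have neg: "q (- x) = - q x" if "x \<in> S" for x
    using add[of x "- x"] that sublinear_zero[OF q(1)] by (simp add: S_closed)
  show thesis
  proof
    show "q (x + y) = q x + q y" if "x \<in> S" "y \<in> S" for x y using that by (rule add)
    show "q (scale t x) = t * q x" if x: "x \<in> S" for t x
    proof (cases "0 \<le> t")
      case True then show ?thesis using sublinear_scale[OF q(1) x] by simp
    next
      case False
      then have "q (scale (- t) x) = (- t) * q x"
        using sublinear_scale[OF q(1) x, of "- t"] by simp
      then show ?thesis using neg[OF S_closed(2)[OF x], of t] by simp
    qed
    show "q x \<le> p x" if "x \<in> S" for x
      using q(2)[OF that] flatten_along_le[OF p that z, of 0] by simp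
    have "q (- z) \<le> p (- z + scale 1 z) - 1 * p z"
      using q(2)[of "- z"] flatten_along_le[OF p _ z, of "- z" 1] z S_closed(4)[OF z] by force
    then show "p z \<le> q z" using neg[OF z] sublinear_zero[OF p] by simp
  qed
qed

end

section \<open>Separation in locally convex function spaces\<close>

lemma topological_linear_space_subspace:
  "topological_linear_space X \<Longrightarrow> fun_space.subspace (topspace X)"
  by (simp add: topological_linear_space_def)

lemmas tls_closed =
  fun_space.subspace_0[OF topological_linear_space_subspace]
  fun_space.subspace_add[OF topological_linear_space_subspace]
  fun_space.subspace_scale[OF topological_linear_space_subspace]
  fun_space.subspace_neg[OF topological_linear_space_subspace]
  fun_space.subspace_diff[OF topological_linear_space_subspace]

lemma continuous_map_affine:
  assumes X: "topological_linear_space X" and a: "a \<in> topspace X"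
  shows "continuous_map X X (\<lambda>f. fscale c (f + a))"
proof -
  have "continuous_map X (prod_topology X X) (\<lambda>f. (f, a))"
    using a by (simp add: continuous_map_pairedI)
  moreover have "continuous_map (prod_topology X X) X (\<lambda>(f, g). f + g)"
    using X by (simp add: topological_linear_space_def)
  ultimately have "continuous_map X X ((\<lambda>(f, g). f + g) \<circ> (\<lambda>f. (f, a)))"
    by (rule continuous_map_compose)
  then have "continuous_map X (prod_topology euclidean X) (\<lambda>f. (c, f + a))"
    by (simp add: continuous_map_pairedI o_def)
  moreover have "continuous_map (prod_topology euclidean X) X (\<lambda>(c, f). fscale c f)"
    using X by (simp add: topological_linear_space_def)
  ultimately have "continuous_map X X ((\<lambda>(c, f). fscale c f) \<circ> (\<lambda>f. (c, f + a)))"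
    by (rule continuous_map_compose)
  then show ?thesis by (simp add: o_def)
qed

lemma open_neighbourhood_absorbing:
  assumes X: "topological_linear_space X" and f: "f \<in> topspace X"
    and V: "openin X V" "0 \<in> V"
  obtains t :: real where "0 < t" "fscale (of_real t) f \<in> V"
proof -
  have "continuous_map euclidean (prod_topology euclidean X) (\<lambda>c. (c::complex, f))"
    using f by (simp add: continuous_map_pairedI)
  moreover have "continuous_map (prod_topology euclidean X) X (\<lambda>(c, f). fscale c f)"
    using X by (simp add: topological_linear_space_def)
  ultimately have "continuous_map euclidean X ((\<lambda>(c, f). fscale c f) \<circ> (\<lambda>c. (c, f)))"
    by (rule continuous_map_compose)
  then have "open {c. fscale c f \<in> V}"
    using V(1) by (auto dest: openin_continuous_map_preimage simp: o_def)
  moreover have "0 \<in> {c. fscale c f \<in> V}" using V(2) by simp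
  ultimately obtain e where e: "0 < e" "ball 0 e \<subseteq> {c. fscale c f \<in> V}"
    using open_contains_ball by blast
  show thesis using e by (intro that[of "e/2"]) (auto simp: subset_iff)
qed

text \<open>By homogeneity, a bound near zero makes \<open>\<phi>\<close> small on small multiples of \<open>W\<close>; translating
  these gives continuity everywhere.\<close>

lemma linear_functional_continuous_if_bounded_near_zero:
  assumes X: "topological_linear_space X"
    and add: "\<And>f g. f \<in> topspace X \<Longrightarrow> g \<in> topspace X \<Longrightarrow> \<phi> (f + g) = \<phi> f + \<phi> g"
    and scale: "\<And>c f. f \<in> topspace X \<Longrightarrow> \<phi> (fscale c f) = c * \<phi> f"
    and W: "openin X W" "0 \<in> W" "\<And>f. f \<in> W \<Longrightarrow> cmod (\<phi> f) \<le> B"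
  shows "continuous_linear_functional X \<phi>"
  unfolding continuous_linear_functional_def
proof (intro conjI ballI allI)
  have "openin X {f \<in> topspace X. \<phi> f \<in> T}" if T: "open T" for T
  proof (subst openin_subopen, intro ballI)
    fix f assume "f \<in> {f \<in> topspace X. \<phi> f \<in> T}"
    then have f: "f \<in> topspace X" "\<phi> f \<in> T" by auto
    obtain e where e: "0 < e" "ball (\<phi> f) e \<subseteq> T" using T f(2) open_contains_ball by blast
    define C where "C = (\<bar>B\<bar> + 1) / e"
    have C: "0 < C" using e by (simp add: C_def)
    (* The translate of (1/C) W by f. *)
    let ?U = "{g \<in> topspace X. fscale (of_real C) (g + (- f)) \<in> W}"
    have "openin X ?U"
      by (rule openin_continuous_map_preimage[OF continuous_map_affine[OF X] W(1)])
        (use tls_closed(4)[OF X] f in auto)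
    moreover have "f \<in> ?U" using f W(2) by simp
    moreover have "?U \<subseteq> {f \<in> topspace X. \<phi> f \<in> T}"
    proof safe
      fix g assume g: "g \<in> topspace X" "fscale (of_real C) (g + (- f)) \<in> W"
      have nf: "- f \<in> topspace X" using tls_closed(4)[OF X] f by blast
      have "\<phi> (- f) = - \<phi> f"
        using add[OF nf f(1)] scale[OF f(1), of 0] by (simp add: add_eq_0_iff)
      then have "\<phi> (fscale (of_real C) (g + (- f))) = of_real C * (\<phi> g - \<phi> f)"
        using scale[OF tls_closed(2)[OF X g(1) nf]] add[OF g(1) nf] by simp
      with W(3)[OF g(2)] have "C * cmod (\<phi> g - \<phi> f) \<le> B"
        using C by (simp add: norm_mult)
      also have "B < C * e" using e by (simp add: C_def)
      finally have "cmod (\<phi> g - \<phi> f) < e" using C by simp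
      then show "\<phi> g \<in> T" using e(2) by (auto simp: dist_norm norm_minus_commute)
    qed
    ultimately show "\<exists>U. openin X U \<and> f \<in> U \<and> U \<subseteq> {f \<in> topspace X. \<phi> f \<in> T}" by blast
  qed
  then show "continuous_map X euclidean \<phi>" by (simp add: continuous_map_def)
qed (use add scale in auto)

text \<open>The Minkowski functional of \<open>V + M\<close> when \<open>M\<close> is a subspace, so for a unit ball \<open>V\<close> the
  distance to \<open>M\<close>.\<close>

definition distance_gauge ::
  "(complex \<Rightarrow> complex) set \<Rightarrow> (complex \<Rightarrow> complex) set \<Rightarrow> (complex \<Rightarrow> complex) \<Rightarrow> real" where
  "distance_gauge V M f = Inf {t. 0 < t \<and> (\<exists>v\<in>V. f - fscale (of_real t) v \<in> M)}"

lemma distance_gauge_le: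
  assumes "0 < t" "v \<in> V" "f - fscale (of_real t) v \<in> M"
  shows "distance_gauge V M f \<le> t"
  unfolding distance_gauge_def using assms
  by (intro cInf_lower) (auto intro!: bdd_belowI[of _ 0])

lemma distance_gauge_set_nonempty:
  assumes X: "topological_linear_space X" and M: "fun_space.subspace M"
    and V: "openin X V" "0 \<in> V" and f: "f \<in> topspace X"
  shows "{t. 0 < t \<and> (\<exists>v\<in>V. f - fscale (of_real t) v \<in> M)} \<noteq> {}"
proof -
  obtain t where t: "0 < t" "fscale (of_real t) f \<in> V"
    by (rule open_neighbourhood_absorbing[OF X f V])
  then have "f - fscale (of_real (1/t)) (fscale (of_real t) f) = 0" by simp
  then have "1/t \<in> {t. 0 < t \<and> (\<exists>v\<in>V. f - fscale (of_real t) v \<in> M)}"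
    using t fun_space.subspace_0[OF M] by (metis (mono_tags, lifting) mem_Collect_eq zero_less_divide_1_iff)
  then show ?thesis by blast
qed

text \<open>Choose a convex neighbourhood \<open>V\<close> of zero such that \<open>f0 - V\<close> misses \<open>M\<close>. The gauge \<open>p\<close> of
  \<open>V + M\<close> is sublinear, is at most \<open>0\<close> on \<open>M\<close>, at most \<open>1\<close> on \<open>V\<close> and at least \<open>1\<close> at \<open>f0\<close>. A real
  linear \<open>l \<le> p\<close> with \<open>l f0 \<ge> p f0\<close> therefore vanishes on \<open>M\<close>, is bounded near zero and does not
  vanish at \<open>f0\<close>. It is the real part of a complex linear functional with the same properties.\<close>

theorem hahn_banach_separation:
  assumes X: "topological_linear_space X" and lc: "locally_convex X"
    and M: "fun_space.subspace M" "M \<subseteq> topspace X"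
    and f0: "f0 \<in> topspace X" "f0 \<notin> X closure_of M"
  obtains \<phi> where "continuous_linear_functional X \<phi>" "\<And>f. f \<in> M \<Longrightarrow> \<phi> f = 0" "\<phi> f0 \<noteq> 0"
proof -
  note Xc = tls_closed[OF X]
  obtain W where W: "openin X W" "f0 \<in> W" "W \<inter> M = {}"
    using f0 by (auto simp: in_closure_of)
  have "openin X {v \<in> topspace X. fscale (-1) (v + (- f0)) \<in> W}"
    by (rule openin_continuous_map_preimage[OF continuous_map_affine[OF X] W(1)])
      (use Xc(4) f0 in auto)
  moreover have "0 \<in> {v \<in> topspace X. fscale (-1) (v + (- f0)) \<in> W}"
    using W(2) Xc(1) by simp
  ultimately obtain V where V: "openin X V" "0 \<in> V" "convex_functions V"
    and VW: "V \<subseteq> {v \<in> topspace X. fscale (-1) (v + (- f0)) \<in> W}"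
    using lc unfolding locally_convex_def by meson
  have VX: "V \<subseteq> topspace X" using V(1) openin_subset by blast
  have far: "f0 - v \<notin> M" if "v \<in> V" for v
    using that VW W(3) by auto
  have convex: "fscale (of_real (1 - t)) v + fscale (of_real t) w \<in> V"
    if "v \<in> V" "w \<in> V" "0 \<le> t" "t \<le> 1" for v w t
    using V(3) that by (auto simp: convex_functions_def)
  interpret real: vector_space "\<lambda>t. fscale (of_real t)"
    by unfold_locales (auto simp: fun_space.scale_right_distrib fun_space.scale_left_distrib)
  interpret real: real_vector_subspace "\<lambda>t. fscale (of_real t)" "topspace X"
    by unfold_locales (use Xc in \<open>simp add: real.subspace_def\<close>)
  let ?D = "\<lambda>f. {t. 0 < t \<and> (\<exists>v\<in>V. f - fscale (of_real t) v \<in> M)}"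
  define p where "p = distance_gauge V M"
  note p_le = distance_gauge_le[of _ _ V _ M, folded p_def]
  have p_ge: "c \<le> p f" if "f \<in> topspace X" "\<And>t. t \<in> ?D f \<Longrightarrow> c \<le> t" for c f
    unfolding p_def distance_gauge_def
    using distance_gauge_set_nonempty[OF X M(1) V(1,2) that(1)] that(2) by (rule cInf_greatest)
  have p_M: "p m \<le> 0" if "m \<in> M" for m
    by (rule field_le_epsilon, rule p_le[of _ 0]) (use that V in auto)
  have "real.sublinear p" unfolding real.sublinear_def
  proof (intro conjI ballI allI impI)
    fix f g assume fg: "f \<in> topspace X" "g \<in> topspace X"
    have sub: "p (f + g) \<le> s + t" if st: "s \<in> ?D f" "t \<in> ?D g" for s t
    proof -
      obtain v w where vw: "v \<in> V" "w \<in> V" "0 < s" "0 < t"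
        "f - fscale (of_real s) v \<in> M" "g - fscale (of_real t) w \<in> M"
        using st by blast
      (* s v + t w is (s + t) times this convex combination. *)
      let ?u = "fscale (of_real (1 - t / (s + t))) v + fscale (of_real (t / (s + t))) w"
      have "?u \<in> V" using vw by (intro convex) auto
      moreover have "(s + t) * (1 - t / (s + t)) = s" "(s + t) * (t / (s + t)) = t"
        using vw by (auto simp: field_simps)
      then have "fscale (of_real (s + t)) ?u = fscale (of_real s) v + fscale (of_real t) w"
        by (metis fun_space.scale_right_distrib fun_space.scale_scale of_real_mult)
      then have "f + g - fscale (of_real (s + t)) ?u
          = (f - fscale (of_real s) v) + (g - fscale (of_real t) w)"
        by (simp only: add_diff_add)
      then have "f + g - fscale (of_real (s + t)) ?u \<in> M"
        using fun_space.subspace_add[OF M(1) vw(5,6)] by (simp only:)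
      ultimately show ?thesis using vw by (intro p_le[of _ ?u]) auto
    qed
    have "p (f + g) - t \<le> p f" if "t \<in> ?D g" for t
      using fg(1) by (rule p_ge) (use sub[OF _ that] in force)
    then have "p (f + g) - p f \<le> p g"
      using fg(2) by (intro p_ge) force+
    then show "p (f + g) \<le> p f + p g" by simp
  next
    fix f and t :: real assume "f \<in> topspace X" "0 \<le> t"
    moreover have "p 0 = 0"
      using p_M[of 0] fun_space.subspace_0[OF M(1)] p_ge[of 0 0] Xc(1) by fastforce
    moreover have "p (fscale (of_real s) f) \<le> s * p f" if f: "f \<in> topspace X" and s: "0 < s" for s f
    proof -
      have "p (fscale (of_real s) f) / s \<le> t" if t: "t \<in> ?D f" for t
      proof -
        obtain v where v: "v \<in> V" "0 < t" "f - fscale (of_real t) v \<in> M" using t by blast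
        have "fscale (of_real s) f - fscale (of_real (s * t)) v \<in> M"
          using fun_space.subspace_scale[OF M(1) v(3), of "of_real s"]
          by (simp add: fun_space.scale_right_diff_distrib)
        then have "p (fscale (of_real s) f) \<le> s * t" using v s by (intro p_le) auto
        then show ?thesis using s by (simp add: field_simps)
      qed
      then have "p (fscale (of_real s) f) / s \<le> p f" using f by (intro p_ge)
      then show ?thesis using s by (simp add: field_simps)
    qed
    ultimately show "p (fscale (of_real t) f) = t * p f" by (intro real.sublinear_homogeneousI)
  qed
  then obtain l where l_add: "\<And>f g. f \<in> topspace X \<Longrightarrow> g \<in> topspace X \<Longrightarrow> l (f + g) = l f + l g"
    and l_scale: "\<And>t f. f \<in> topspace X \<Longrightarrow> l (fscale (of_real t) f) = t * l f"
    and l_le: "\<And>f. f \<in> topspace X \<Longrightarrow> l f \<le> p f" and l_f0: "p f0 \<le> l f0"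
    using real.hahn_banach[OF _ f0(1)] by metis
  have l_neg: "l (- f) = - l f" if "f \<in> topspace X" for f
    using l_scale[OF that, of "-1"] by simp
  have l_M: "l m = 0" if "m \<in> M" for m
    using l_le[of m] l_le[of "- m"] p_M[of m] p_M[of "- m"] l_neg[of m]
      fun_space.subspace_neg[OF M(1) that] that M(2) by force
  have "1 \<le> p f0"
  proof (rule p_ge[OF f0(1)])
    fix t assume "t \<in> ?D f0"
    then obtain v where v: "v \<in> V" "0 < t" "f0 - fscale (of_real t) v \<in> M" by blast
    (* For t < 1 the vector t v would still lie in V, by convexity. *)
    show "1 \<le> t"
    proof (rule ccontr)
      assume "\<not> 1 \<le> t"
      then have "fscale (of_real t) v \<in> V" using convex[OF V(2) v(1), of t] v(2) by simp
      then show False using far v(3) by blast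
    qed
  qed
  then have l_f0: "1 \<le> l f0" using l_f0 by simp
  (* The only complex linear functional with real part l. *)
  define \<phi> where "\<phi> f = Complex (l f) (- l (fscale \<i> f))" for f
  have i: "fscale \<i> f \<in> topspace X" if "f \<in> topspace X" for f using that by (rule Xc(3))
  have "continuous_linear_functional X \<phi>"
  proof (rule linear_functional_continuous_if_bounded_near_zero[OF X])
    show "\<phi> (f + g) = \<phi> f + \<phi> g" if "f \<in> topspace X" "g \<in> topspace X" for f g
      using that by (simp add: \<phi>_def fun_space.scale_right_distrib l_add i complex_eq_iff)
    show "\<phi> (fscale c f) = c * \<phi> f" if f: "f \<in> topspace X" for c f
    proof -
      have "fscale c f = fscale (of_real (Re c)) f + fscale (of_real (Im c)) (fscale \<i> f)"
        by (simp add: fun_eq_iff fscale_def complex_eq_iff)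
      moreover have "fscale \<i> (fscale c f)
          = fscale (of_real (Re c)) (fscale \<i> f) + fscale (of_real (- Im c)) f"
        by (simp add: fun_eq_iff fscale_def complex_eq_iff)
      ultimately have "l (fscale c f) = Re c * l f + Im c * l (fscale \<i> f)"
        "l (fscale \<i> (fscale c f)) = Re c * l (fscale \<i> f) - Im c * l f"
        using f i[OF f] by (simp_all only: l_add l_scale Xc(3))
      then show ?thesis by (simp add: \<phi>_def complex_eq_iff)
    qed
    (* V need not be balanced, and bounding both parts of \<phi> takes the four directions 1, -1, i, -i. *)
    let ?V = "\<lambda>c. {f \<in> topspace X. fscale c (f + 0) \<in> V}"
    let ?W = "?V 1 \<inter> ?V (-1) \<inter> ?V \<i> \<inter> ?V (- \<i>)"
    have "openin X (?V c)" for c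
      by (rule openin_continuous_map_preimage[OF continuous_map_affine[OF X Xc(1)] V(1)])
    then show "openin X ?W" by (intro openin_Int)
    show "0 \<in> ?W" using V(2) Xc(1) by simp
    have l_V: "l v \<le> 1" if "v \<in> V" for v
      using l_le[of v] p_le[of 1 v v] that VX fun_space.subspace_0[OF M(1)] by force
    show "cmod (\<phi> f) \<le> 2" if f: "f \<in> ?W" for f
    proof -
      have "\<bar>l f\<bar> \<le> 1" "\<bar>l (fscale \<i> f)\<bar> \<le> 1"
        using f l_V[of f] l_V[of "- f"] l_V[of "fscale \<i> f"] l_V[of "- fscale \<i> f"]
          l_neg[of f] l_neg[OF i, of f] by auto
      then show ?thesis
        using cmod_le[of "\<phi> f"] by (simp add: \<phi>_def)
    qed
  qed
  moreover have "\<phi> m = 0" if "m \<in> M" for m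
    using l_M[OF that] l_M[OF fun_space.subspace_scale[OF M(1) that]] by (simp add: \<phi>_def complex_eq_iff)
  moreover have "\<phi> f0 \<noteq> 0" using l_f0 by (simp add: \<phi>_def complex_eq_iff)
  ultimately show thesis by (rule that)
qed

section \<open>Functionals on the Hardy space and the Cauchy pairing\<close>

lemma hol_disc_power_series:
  assumes "\<And>z. z \<in> ball 0 1 \<Longrightarrow> (\<lambda>n. a n * z ^ n) sums f z" and "\<And>z. z \<notin> ball 0 1 \<Longrightarrow> f z = 0"
  shows "f \<in> hol_disc" and "taylor_coeff f n = a n"
proof -
  show "f \<in> hol_disc"
    using assms power_series_holomorphic[of 0 1 a f] by (simp add: hol_disc_def)
  have "eventually (\<lambda>z. z \<in> ball 0 1) (nhds (0::complex))"
    by (intro eventually_nhds_in_open) auto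
  then have "f has_fps_expansion Abs_fps a"
    by (intro has_fps_expansionI) (auto elim!: eventually_mono intro: assms)
  then show "taylor_coeff f n = a n"
    using fps_nth_fps_expansion[of f "Abs_fps a" n] by (simp add: taylor_coeff_def)
qed

text \<open>The monomials and polynomials as members of \<^const>\<open>hol_disc\<close>, hence cut off outside the
  disc.\<close>

definition disc_monomial :: "nat \<Rightarrow> complex \<Rightarrow> complex" where
  "disc_monomial n z = (if z \<in> ball 0 1 then z ^ n else 0)"

definition disc_polynomial :: "(nat \<Rightarrow> complex) \<Rightarrow> nat \<Rightarrow> complex \<Rightarrow> complex" where
  "disc_polynomial a N z = (if z \<in> ball 0 1 then \<Sum>n<N. a n * z ^ n else 0)"

lemma disc_polynomial_sums:
  assumes "z \<in> ball 0 1"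
  shows "(\<lambda>n. (if n < N then a n else 0) * z ^ n) sums disc_polynomial a N z"
proof -
  have "(\<lambda>n. if n \<in> {..<N} then a n * z ^ n else 0) sums (\<Sum>n<N. a n * z ^ n)"
    by (rule sums_If_finite_set) simp
  also have "(\<lambda>n. if n \<in> {..<N} then a n * z ^ n else 0) = (\<lambda>n. (if n < N then a n else 0) * z ^ n)"
    by auto
  finally show ?thesis using assms by (simp add: disc_polynomial_def)
qed

lemma taylor_coeff_disc_polynomial:
  "taylor_coeff (disc_polynomial a N) n = (if n < N then a n else 0)"
  by (rule hol_disc_power_series(2)[OF disc_polynomial_sums]) (auto simp: disc_polynomial_def)

lemma disc_polynomial_hardy2: "disc_polynomial a N \<in> hardy2"
proof -
  have "disc_polynomial a N \<in> hol_disc"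
    by (rule hol_disc_power_series(1)[OF disc_polynomial_sums]) (auto simp: disc_polynomial_def)
  moreover have "summable (\<lambda>n. (cmod (taylor_coeff (disc_polynomial a N) n))\<^sup>2)"
    by (rule summable_finite[of "{..<N}"]) (auto simp: taylor_coeff_disc_polynomial)
  ultimately show ?thesis by (simp add: hardy2_def)
qed

lemma hardy2_norm_disc_polynomial:
  "hardy2_norm (disc_polynomial a N) = sqrt (\<Sum>n<N. (cmod (a n))\<^sup>2)"
proof -
  have "(\<Sum>n. (cmod (taylor_coeff (disc_polynomial a N) n))\<^sup>2)
      = (\<Sum>n<N. (cmod (taylor_coeff (disc_polynomial a N) n))\<^sup>2)"
    by (rule suminf_finite) (auto simp: taylor_coeff_disc_polynomial)
  then show ?thesis by (simp add: hardy2_norm_def taylor_coeff_disc_polynomial)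
qed

lemma disc_monomial_hardy2: "disc_monomial n \<in> hardy2"
proof -
  have "disc_monomial n = disc_polynomial (\<lambda>m. if m = n then 1 else 0) (Suc n)"
    by (auto simp: fun_eq_iff disc_monomial_def disc_polynomial_def)
  then show ?thesis by (simp add: disc_polynomial_hardy2)
qed

lemma hol_disc_eqI:
  assumes "f \<in> hol_disc" "g \<in> hol_disc" "\<And>n. taylor_coeff f n = taylor_coeff g n"
  shows "f = g"
proof
  fix z show "f z = g z"
  proof (cases "z \<in> ball 0 1")
    case True
    then show ?thesis
      using taylor_coeff_sums[OF assms(1) True] taylor_coeff_sums[OF assms(2) True] assms(3)
      by (simp add: sums_unique2)
  qed (use assms in \<open>auto simp: hol_disc_def\<close>)
qed

lemma taylor_coeff_zero [simp]: "taylor_coeff 0 n = 0"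
  by (rule hol_disc_power_series(2)[where a = "\<lambda>_. 0"]) auto

lemma zero_hardy2: "0 \<in> hardy2"
proof -
  have "0 \<in> hol_disc" by (rule hol_disc_power_series(1)[where a = "\<lambda>_. 0"]) auto
  then show ?thesis by (simp add: hardy2_def)
qed

lemma taylor_coeff_fscale:
  assumes "f \<in> hol_disc"
  shows "fscale c f \<in> hol_disc" and "taylor_coeff (fscale c f) n = c * taylor_coeff f n"
proof -
  have s: "(\<lambda>n. (c * taylor_coeff f n) * z ^ n) sums fscale c f z" if "z \<in> ball 0 1" for z
    using sums_mult[OF taylor_coeff_sums[OF assms that], of c]
    by (simp add: fscale_def mult.assoc)
  have z: "fscale c f z = 0" if "z \<notin> ball 0 1" for z
    using assms that by (auto simp: fscale_def hol_disc_def)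
  show "fscale c f \<in> hol_disc"
    by (rule hol_disc_power_series(1)[OF s z])
  show "taylor_coeff (fscale c f) n = c * taylor_coeff f n"
    by (rule hol_disc_power_series(2)[OF s z])
qed

lemma hardy2_fscale:
  assumes "f \<in> hardy2"
  shows "fscale c f \<in> hardy2" and "hardy2_norm (fscale c f) = cmod c * hardy2_norm f"
  using assms
  by (auto simp: hardy2_def hardy2_norm_def taylor_coeff_fscale norm_mult power_mult_distrib
      summable_mult suminf_mult real_sqrt_mult)

lemma hardy2_subspace: "fun_space.subspace hardy2"
proof (rule fun_space.subspaceI)
  fix f g assume "f \<in> hardy2" "g \<in> hardy2"
  then have "f - fscale (-1) g \<in> hardy2" by (intro hardy2_diff hardy2_fscale)
  then show "f + g \<in> hardy2" by simp
qed (auto simp: zero_hardy2 hardy2_fscale)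

lemma hardy2_norm_eq_0: 
  assumes "f \<in> hardy2" "hardy2_norm f = 0" shows "f = 0"
proof (rule hol_disc_eqI)
  show "f \<in> hol_disc" "0 \<in> hol_disc" using assms zero_hardy2 by (auto simp: hardy2_def)
  show "taylor_coeff f n = taylor_coeff 0 n" for n
    using assms suminf_eq_zero_iff[of "\<lambda>n. (cmod (taylor_coeff f n))\<^sup>2"]
    by (simp add: hardy2_norm_def hardy2_def)
qed

lemma hardy2_norm_tail_tendsto_0:
  assumes f: "f \<in> hardy2"
  shows "(\<lambda>N. hardy2_norm (f - disc_polynomial (taylor_coeff f) N)) \<longlonglongrightarrow> 0"
proof -
  let ?u = "\<lambda>n. (cmod (taylor_coeff f n))\<^sup>2"
  have sm: "summable ?u" using f by (simp add: hardy2_def)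
  have "hardy2_norm (f - disc_polynomial (taylor_coeff f) N) = sqrt (suminf ?u - (\<Sum>n<N. ?u n))" for N
  proof -
    have "(\<Sum>n. (cmod (taylor_coeff (f - disc_polynomial (taylor_coeff f) N) n))\<^sup>2)
        = (\<Sum>n. ?u n - (if n \<in> {..<N} then ?u n else 0))"
      using f disc_polynomial_hardy2
      by (intro suminf_cong) (auto simp: hardy2_def taylor_coeff_diff taylor_coeff_disc_polynomial)
    also have "\<dots> = suminf ?u - (\<Sum>n. if n \<in> {..<N} then ?u n else 0)"
      by (rule suminf_diff[symmetric, OF sm]) (rule summable_If_finite_set, simp)
    also have "(\<Sum>n. if n \<in> {..<N} then ?u n else 0) = (\<Sum>n<N. ?u n)"
      using sums_If_finite_set[of "{..<N}" ?u] by (simp add: sums_iff)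
    finally show ?thesis unfolding hardy2_norm_def by (simp only:)
  qed
  moreover have "(\<lambda>N. sqrt (suminf ?u - (\<Sum>n<N. ?u n))) \<longlonglongrightarrow> sqrt (suminf ?u - suminf ?u)"
    by (intro tendsto_intros summable_LIMSEQ sm)
  ultimately show ?thesis by simp
qed

text \<open>The usual scaling argument: \<open>\<phi>\<close> is less than \<open>1\<close> on some ball of radius \<open>d\<close>, and every nonzero
  \<open>f\<close> can be scaled to norm \<open>d / 2\<close>.\<close>

lemma hardy2_functional_bounded:
  assumes H: "hardy2 \<subseteq> topspace X" and cont: "continuous_map hardy2_topology X (\<lambda>f. f)"
    and \<phi>: "continuous_linear_functional X \<phi>"
  obtains C where "0 \<le> C" "\<And>f. f \<in> hardy2 \<Longrightarrow> cmod (\<phi> f) \<le> C * hardy2_norm f"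
proof -
  interpret Metric_space hardy2 hardy2_dist by (rule Metric_space_hardy2)
  have scale: "\<phi> (fscale c f) = c * \<phi> f" if "f \<in> hardy2" for c f
    using \<phi> H that by (auto simp: continuous_linear_functional_def)
  have zero: "\<phi> 0 = 0" using scale[OF zero_hardy2, of 0] by simp
  have "continuous_map mtopology euclidean (\<phi> \<circ> (\<lambda>f. f))"
    using cont \<phi> unfolding hardy2_topology_def continuous_linear_functional_def
    by (blast intro: continuous_map_compose)
  then have "openin mtopology {f \<in> topspace mtopology. (\<phi> \<circ> (\<lambda>f. f)) f \<in> ball 0 1}"
    by (rule openin_continuous_map_preimage) simp
  then have "openin mtopology {f \<in> hardy2. \<phi> f \<in> ball 0 1}" by simp
  moreover have "0 \<in> {f \<in> hardy2. \<phi> f \<in> ball 0 1}" using zero zero_hardy2 by simp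
  ultimately obtain d where d: "0 < d" "mball 0 d \<subseteq> {f \<in> hardy2. \<phi> f \<in> ball 0 1}"
    unfolding openin_mtopology by blast
  have small: "cmod (\<phi> f) < 1" if "f \<in> hardy2" "hardy2_norm f < d" for f
  proof -
    have "hardy2_dist 0 f = hardy2_norm f"
      using that zero_hardy2 commute[of 0 f] by (simp add: hardy2_dist_def)
    then have "f \<in> mball 0 d" using that zero_hardy2 by simp
    then show ?thesis using d(2) by auto
  qed
  show thesis
  proof (rule that[of "2 / d"])
    show "0 \<le> 2 / d" using d by simp
    fix f assume f: "f \<in> hardy2"
    show "cmod (\<phi> f) \<le> 2 / d * hardy2_norm f"
    proof (cases "hardy2_norm f = 0")
      case True then show ?thesis using hardy2_norm_eq_0[OF f True] zero by simp
    next
      case False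
      then have n: "0 < hardy2_norm f" using hardy2_norm_nonneg[OF f] by simp
      let ?c = "d / (2 * hardy2_norm f)"
      have "cmod (\<phi> (fscale (of_real ?c) f)) < 1"
        using n d f by (intro small) (auto simp: hardy2_fscale simp del: of_real_divide)
      then have "?c * cmod (\<phi> f) < 1"
        using n d by (simp add: scale[OF f] norm_mult del: of_real_divide)
      then show ?thesis using n d by (simp add: field_simps)
    qed
  qed
qed

text \<open>Evaluating \<open>\<phi>\<close> at the polynomial \<open>p\<close> with coefficients \<open>cnj (\<phi> z\<^sup>n)\<close>, \<open>n < N\<close>, gives
  \<open>s = \<Sum>n<N. \<bar>\<phi> z\<^sup>n\<bar>\<^sup>2\<close>, while \<open>p\<close> has norm \<open>sqrt s\<close>; boundedness then gives \<open>s \<le> C sqrt s\<close>, so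
  \<open>s \<le> C\<^sup>2\<close> for every \<open>N\<close>. The expansion of \<open>\<phi> f\<close> holds because Taylor polynomials converge in
  \<open>H\<^sup>2\<close>.\<close>

proposition hardy2_functional_coefficients:
  assumes H: "hardy2 \<subseteq> topspace X" and cont: "continuous_map hardy2_topology X (\<lambda>f. f)"
    and \<phi>: "continuous_linear_functional X \<phi>"
  shows "summable (\<lambda>n. (cmod (\<phi> (disc_monomial n)))\<^sup>2)"
    and "f \<in> hardy2 \<Longrightarrow> (\<lambda>n. taylor_coeff f n * \<phi> (disc_monomial n)) sums \<phi> f"
proof -
  obtain C where C: "0 \<le> C" "\<And>f. f \<in> hardy2 \<Longrightarrow> cmod (\<phi> f) \<le> C * hardy2_norm f"
    using hardy2_functional_bounded[OF H cont \<phi>] by blast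
  have scale: "\<phi> (fscale c f) = c * \<phi> f" if "f \<in> hardy2" for c f
    using \<phi> H that by (auto simp: continuous_linear_functional_def)
  have add: "\<phi> (f + g) = \<phi> f + \<phi> g" if "f \<in> hardy2" "g \<in> hardy2" for f g
    using \<phi> H that unfolding continuous_linear_functional_def by blast
  have poly: "\<phi> (disc_polynomial a N) = (\<Sum>n<N. a n * \<phi> (disc_monomial n))" for a N
  proof (induction N)
    case 0
    have "disc_polynomial a 0 = 0" by (auto simp: disc_polynomial_def)
    moreover have "\<phi> 0 = 0" using scale[OF zero_hardy2, of 0] by simp
    ultimately show ?case by (simp only: lessThan_0 sum.empty)
  next
    case (Suc N)
    have "disc_polynomial a (Suc N) = disc_polynomial a N + fscale (a N) (disc_monomial N)"
      by (auto simp: fun_eq_iff disc_polynomial_def disc_monomial_def fscale_def)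
    moreover have "\<phi> (disc_polynomial a N + fscale (a N) (disc_monomial N))
        = \<phi> (disc_polynomial a N) + a N * \<phi> (disc_monomial N)"
      by (simp only: add disc_polynomial_hardy2 hardy2_fscale(1) disc_monomial_hardy2 scale)
    ultimately show ?case by (simp only: Suc sum.lessThan_Suc)
  qed
  let ?s = "\<lambda>N. \<Sum>n<N. (cmod (\<phi> (disc_monomial n)))\<^sup>2"
  have bound: "?s N \<le> C\<^sup>2" for N
  proof -
    let ?p = "disc_polynomial (\<lambda>n. cnj (\<phi> (disc_monomial n))) N"
    have "\<phi> ?p = of_real (?s N)"
      unfolding poly by (simp add: complex_norm_square mult.commute del: of_real_power)
    moreover have "0 \<le> ?s N" by (simp add: sum_nonneg)
    ultimately have "?s N \<le> C * sqrt (?s N)"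
      using C(2)[OF disc_polynomial_hardy2, of "\<lambda>n. cnj (\<phi> (disc_monomial n))" N]
      by (simp add: hardy2_norm_disc_polynomial del: of_real_sum)
    then have "sqrt (?s N) * sqrt (?s N) \<le> C * sqrt (?s N)"
      using \<open>0 \<le> ?s N\<close> by simp
    then have "sqrt (?s N) \<le> C"
      using C(1) \<open>0 \<le> ?s N\<close> mult_right_le_imp_le[of "sqrt (?s N)" "sqrt (?s N)" C]
      by (cases "?s N = 0") auto
    then show ?thesis using sqrt_le_D by blast
  qed
  show "summable (\<lambda>n. (cmod (\<phi> (disc_monomial n)))\<^sup>2)"
    by (rule bounded_imp_summable[where B = "C\<^sup>2"])
      (use bound[of "Suc _"] in \<open>auto simp: lessThan_Suc_atMost\<close>)
  assume f: "f \<in> hardy2"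
  have error: "norm ((\<Sum>n<N. taylor_coeff f n * \<phi> (disc_monomial n)) - \<phi> f)
      \<le> C * hardy2_norm (f - disc_polynomial (taylor_coeff f) N)" for N
  proof -
    let ?p = "disc_polynomial (taylor_coeff f) N"
    have d: "f - ?p \<in> hardy2" using f disc_polynomial_hardy2 by (rule hardy2_diff)
    have "\<phi> f = \<phi> ((f - ?p) + ?p)" by (rule arg_cong[of _ _ \<phi>]) (rule diff_add_cancel[symmetric])
    also have "\<dots> = \<phi> (f - ?p) + \<phi> ?p" by (rule add[OF d disc_polynomial_hardy2])
    finally have split: "\<phi> f = \<phi> (f - ?p) + \<phi> ?p" .
    have "w - v = - u" if "v = u + w" for u v w :: complex using that by simp
    from this[OF split]
    have "(\<Sum>n<N. taylor_coeff f n * \<phi> (disc_monomial n)) - \<phi> f = - \<phi> (f - ?p)"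
      by (simp only: poly)
    then show ?thesis using C(2)[OF d] by (simp only: norm_minus_cancel)
  qed
  have "(\<lambda>N. (\<Sum>n<N. taylor_coeff f n * \<phi> (disc_monomial n)) - \<phi> f) \<longlonglongrightarrow> 0"
  proof (rule Lim_null_comparison)
    show "\<forall>\<^sub>F N in sequentially. norm ((\<Sum>n<N. taylor_coeff f n * \<phi> (disc_monomial n)) - \<phi> f)
        \<le> C * hardy2_norm (f - disc_polynomial (taylor_coeff f) N)"
      by (rule always_eventually) (rule allI, rule error)
    show "(\<lambda>N. C * hardy2_norm (f - disc_polynomial (taylor_coeff f) N)) \<longlonglongrightarrow> 0"
      by (rule tendsto_mult_right_zero) (rule hardy2_norm_tail_tendsto_0[OF f])
  qed
  then show "(\<lambda>n. taylor_coeff f n * \<phi> (disc_monomial n)) sums \<phi> f"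
    unfolding sums_def by (rule LIM_zero_cancel)
qed

text \<open>On the circle of radius \<open>r\<close>, \<open>cnj (z\<^sup>n) = r\<^sup>2\<^sup>n / z\<^sup>n\<close>, so the conjugate of the circle mean is
  \<open>r\<^sup>2\<^sup>n\<close> times Cauchy's integral for the \<open>n\<close>-th Taylor coefficient of \<open>g\<close>; then let \<open>r\<close> tend to
  \<open>1\<close>.\<close>

lemma cauchy_pairing_monomial:
  assumes g: "g \<in> hol_disc"
  shows "has_cauchy_pairing (disc_monomial n) g (cnj (taylor_coeff g n))"
proof -
  have mean: "circle_mean (\<lambda>\<zeta>. disc_monomial n (of_real r * \<zeta>) * cnj (g (of_real r * \<zeta>)))
      = of_real (r ^ (2 * n)) * cnj (taylor_coeff g n)" if r: "0 < r" "r < 1" for r :: real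
  proof -
    have hol: "g holomorphic_on ball 0 1" using g by (simp add: hol_disc_def)
    have "((\<lambda>u. g u / (u - 0) ^ Suc n) has_contour_integral
        (2 * pi * \<i>) / fact n * (deriv ^^ n) g 0) (circlepath 0 r)"
      using r by (intro Cauchy_has_contour_integral_higher_derivative_circlepath
          holomorphic_on_imp_continuous_on holomorphic_on_subset[OF hol]) auto
    then have int: "((\<lambda>t. g (r * cis t) / (r * cis t) ^ Suc n * r * \<i> * cis t) has_integral
        (2 * pi * \<i>) * taylor_coeff g n) {0..2 * pi}"
      using r by (simp add: circlepath_def has_contour_integral_part_circlepath_iff taylor_coeff_def)
    have conj: "cnj (of_real r * cis t) ^ n = of_real (r ^ (2 * n)) / (of_real r * cis t) ^ n" for t
    proof -
      have "cnj (of_real r * cis t) * (of_real r * cis t) = of_real (r\<^sup>2)"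
        by (simp add: cis_cnj cis_mult power2_eq_square)
      then have "cnj (of_real r * cis t) ^ n * (of_real r * cis t) ^ n = of_real (r ^ (2 * n))"
        by (simp only: power_mult of_real_power flip: power_mult_distrib)
      then show ?thesis using r by (subst eq_divide_eq) (auto simp: cis_neq_zero)
    qed
    let ?F = "\<lambda>t. - \<i> * of_real (r ^ (2 * n)) *
        (g (r * cis t) / (r * cis t) ^ Suc n * r * \<i> * cis t)"
    let ?G = "\<lambda>t. disc_monomial n (of_real r * cis t) * cnj (g (of_real r * cis t))"
    let ?I = "- \<i> * of_real (r ^ (2 * n)) * ((2 * pi * \<i>) * taylor_coeff g n)"
    have FG: "cnj \<circ> ?F = ?G"
    proof
      fix t
      have "?F t = g (r * cis t) * (of_real (r ^ (2 * n)) / (r * cis t) ^ n)"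
        using r by (simp add: field_simps cis_neq_zero)
      also have "\<dots> = g (r * cis t) * cnj (of_real r * cis t) ^ n" by (simp only: conj)
      finally have "cnj (?F t) = cnj (g (r * cis t) * cnj (of_real r * cis t) ^ n)" by (rule arg_cong)
      then show "(cnj \<circ> ?F) t = ?G t"
        using r by (simp add: disc_monomial_def norm_mult mult.commute)
    qed
    have "((cnj \<circ> ?F) has_integral cnj ?I) {0..2 * pi}"
      by (intro has_integral_linear[OF _ bounded_linear_cnj] has_integral_mult_right int)
    then have "integral {0..2 * pi} ?G = cnj ?I"
      unfolding FG by (rule integral_unique)
    then show ?thesis by (simp add: circle_mean_def field_simps)
  qed
  have "((\<lambda>r. of_real (r ^ (2 * n)) * cnj (taylor_coeff g n)) \<longlongrightarrow>
      of_real (1 ^ (2 * n)) * cnj (taylor_coeff g n)) (at_left (1::real))"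
    by (intro tendsto_intros)
  moreover have "eventually (\<lambda>r. r \<in> {0<..<1}) (at_left (1::real))"
    by (rule eventually_at_left_real) simp
  then have "eventually (\<lambda>r. of_real (r ^ (2 * n)) * cnj (taylor_coeff g n)
      = circle_mean (\<lambda>\<zeta>. disc_monomial n (of_real r * \<zeta>) * cnj (g (of_real r * \<zeta>)))) (at_left (1::real))"
    by eventually_elim (use mean in auto)
  ultimately show ?thesis
    unfolding has_cauchy_pairing_def using Lim_transform_eventually by fastforce
qed

lemma has_cauchy_pairing_unique:
  "has_cauchy_pairing f g c \<Longrightarrow> has_cauchy_pairing f g d \<Longrightarrow> c = d"
  unfolding has_cauchy_pairing_def by (rule tendsto_unique[OF trivial_limit_at_left_real])

section \<open>Membership of the generators in the Hardy space\<close>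

text \<open>The two comparisons of a harmonic sum with \<open>\<integral> dx / x\<close>. The shifts in the lower one are
  what makes both sides comparable with \<open>ln k\<close> when \<open>m = n div k\<close>.\<close>

lemma harm_diff_le_ln: 
  assumes "0 < m" "m \<le> n" shows "harm n - harm m \<le> ln (real n / real m)"
  using assms(2)
proof (induction n rule: dec_induct)
  case base then show ?case using assms by simp
next
  case (step n)
  have "ln (real n) - ln (real (Suc n)) \<le> (real n - real (Suc n)) / real (Suc n)"
    using assms step by (intro ln_diff_le) auto
  also have "\<dots> = - inverse (real (Suc n))" by (simp add: divide_simps)
  finally have "inverse (real (Suc n)) \<le> ln (real (Suc n)) - ln (real n)" by simp
  then show ?case using step assms by (simp add: harm_Suc ln_div)
qed

lemma harm_diff_ge_ln:
  assumes "m \<le> n" shows "ln (real (Suc n) / real (Suc m)) \<le> harm n - harm m"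
  using assms
proof (induction n rule: dec_induct)
  case base then show ?case by simp
next
  case (step n)
  have "ln (real (Suc (Suc n))) - ln (real (Suc n))
      \<le> (real (Suc (Suc n)) - real (Suc n)) / real (Suc n)"
    by (intro ln_diff_le) auto
  also have "\<dots> = inverse (real (Suc n))" by (simp add: divide_simps)
  finally have "ln (real (Suc (Suc n))) - ln (real (Suc n)) \<le> inverse (real (Suc n))" .
  then show ?case using step by (simp add: harm_Suc ln_div)
qed

text \<open>These are the Taylor coefficients of \<open>h\<^sub>k\<close>, see \<open>h_fun_sums\<close>.\<close>

definition h_coeff :: "nat \<Rightarrow> nat \<Rightarrow> real" where
  "h_coeff k n = harm n - harm (n div k) - ln (real k)"

text \<open>Let \<open>m = n div k\<close>, so \<open>k m \<le> n < k (m + 1)\<close>. Both \<open>H\<^sub>n - H\<^sub>m\<close> and \<open>ln k\<close> then lie between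
  \<open>ln ((n + 1) / (m + 1))\<close> and \<open>ln (n / m)\<close>, an interval of length at most
  \<open>ln ((m + 1) / m) \<le> 1 / m\<close>, and \<open>m\<close> is comparable with \<open>n / k\<close>.\<close>

lemma h_coeff_bound:
  assumes k: "0 < k" and n: "k \<le> n"
  shows "\<bar>h_coeff k n\<bar> \<le> 2 * real k / real n"
proof -
  define m where "m = n div k"
  have "k * m \<le> n" by (simp add: m_def)
  then have m1: "real k * real m \<le> real n" by (metis of_nat_le_iff of_nat_mult)
  have "Suc n \<le> k * Suc m" 
    using k dividend_less_times_div[of k n] by (simp add: m_def Suc_le_eq)
  then have m2: "real (Suc n) \<le> real k * real (Suc m)" by (metis of_nat_le_iff of_nat_mult)
  have m0: "0 < m" using k n by (simp add: m_def div_greater_zero_iff)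
  have mn: "m \<le> n" by (simp add: m_def)
  have n0: "0 < real n" "0 < real k" using k n by auto
  have hi: "harm n - harm m \<le> ln (real n) - ln (real m)"
    using harm_diff_le_ln[OF m0 mn] m0 n0 by (simp add: ln_div)
  have lo: "ln (real (Suc n)) - ln (real (Suc m)) \<le> harm n - harm m"
    using harm_diff_ge_ln[OF mn] by (simp add: ln_div)
  have "ln (real k * real m) \<le> ln (real n)" using m1 m0 n0 by simp
  then have k_hi: "ln (real k) \<le> ln (real n) - ln (real m)" using m0 n0 by (simp add: ln_mult)
  have "ln (real (Suc n)) \<le> ln (real k * real (Suc m))" using m2 by simp
  then have k_lo: "ln (real (Suc n)) - ln (real (Suc m)) \<le> ln (real k)"
    using n0 by (simp add: ln_mult)
  have "ln (real (Suc m)) - ln (real m) \<le> (real (Suc m) - real m) / real m"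
    using m0 by (intro ln_diff_le) auto
  moreover have "ln (real n) \<le> ln (real (Suc n))" using n0 by simp
  ultimately have "\<bar>h_coeff k n\<bar> \<le> 1 / real m"
    using hi lo k_hi k_lo unfolding h_coeff_def m_def[symmetric] by (simp add: abs_le_iff)
  also have "real n \<le> 2 * real k * real m"
  proof -
    have "real k * 1 \<le> real k * real m" using m0 n0 by (intro mult_left_mono) auto
    then show ?thesis using m2 by (simp add: algebra_simps)
  qed
  then have "1 / real m \<le> 2 * real k / real n" using m0 n0 by (simp add: field_simps)
  finally show ?thesis .
qed

lemma h_coeff_square_summable:
  assumes "0 < k" shows "summable (\<lambda>n. (h_coeff k n)\<^sup>2)"
proof (rule summable_comparison_test')
  show "summable (\<lambda>n. (2 * real k)\<^sup>2 * inverse (real n ^ 2))"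
    by (intro summable_mult inverse_power_summable) simp
  fix n assume "k \<le> n"
  then have "\<bar>h_coeff k n\<bar>\<^sup>2 \<le> (2 * real k / real n)\<^sup>2"
    by (intro power_mono h_coeff_bound assms) auto
  then show "norm ((h_coeff k n)\<^sup>2) \<le> (2 * real k)\<^sup>2 * inverse (real n ^ 2)"
    by (simp add: power_divide divide_inverse power_mult_distrib power_inverse)
qed

text \<open>By \<open>x y \<le> x\<^sup>2 + y\<^sup>2\<close> the terms are dominated by a square summable and a geometric part.\<close>

lemma square_summable_imp_power_series_summable:
  fixes a :: "nat \<Rightarrow> complex"
  assumes "summable (\<lambda>n. (cmod (a n))\<^sup>2)" and z: "cmod z < 1"
  shows "summable (\<lambda>n. a n * z ^ n)"
proof (rule summable_comparison_test')
  have "(cmod z)\<^sup>2 < 1" using z by (simp add: abs_square_less_1)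
  then have "summable (\<lambda>n. ((cmod z)\<^sup>2) ^ n)" by (intro summable_geometric) simp
  then show "summable (\<lambda>n. (cmod (a n))\<^sup>2 + ((cmod z)\<^sup>2) ^ n)"
    using assms(1) by (rule summable_add[rotated])
  fix n :: nat
  have "cmod (a n) * cmod z ^ n \<le> (cmod (a n))\<^sup>2 + (cmod z ^ n)\<^sup>2"
  proof -
    have "0 \<le> cmod (a n) * cmod z ^ n" by simp
    then show ?thesis
      using sum_squares_bound[of "cmod (a n)" "cmod z ^ n"] by linarith
  qed
  then show "norm (a n * z ^ n) \<le> (cmod (a n))\<^sup>2 + ((cmod z)\<^sup>2) ^ n"
    by (simp add: norm_mult norm_power flip: power_mult) (simp add: mult.commute)
qed

text \<open>Principal branches are compatible here because \<open>1 - z\<close> and \<open>1 - z\<^sup>k\<close> lie in the right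
  half-plane: each logarithm has imaginary part below \<open>\<pi>/2\<close>, so the difference stays in the
  principal strip.\<close>

lemma Ln_geometric_mean:
  assumes k: "0 < k" and z: "cmod z < 1"
  shows "Ln ((\<Sum>i<k. z ^ i) / of_nat k) = Ln (1 - z ^ k) - Ln (1 - z) - of_real (ln (real k))"
proof (rule Ln_unique)
  have zk: "cmod (z ^ k) < 1" using k z by (simp add: norm_power power_less_one_iff)
  have Im: "\<bar>Im (Ln (1 - w))\<bar> < pi / 2" "1 - w \<noteq> 0" if "cmod w < 1" for w
    using that complex_Re_le_cmod[of w] Re_Ln_pos_lt_imp[of "1 - w"] by auto
  show "exp (Ln (1 - z ^ k) - Ln (1 - z) - of_real (ln (real k))) = (\<Sum>i<k. z ^ i) / of_nat k"
    using Im(2)[OF z] Im(2)[OF zk] k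
    by (simp add: exp_diff exp_of_real one_diff_power_eq)
  show "- pi < Im (Ln (1 - z ^ k) - Ln (1 - z) - of_real (ln (real k)))"
    "Im (Ln (1 - z ^ k) - Ln (1 - z) - of_real (ln (real k))) \<le> pi"
    using Im(1)[OF z] Im(1)[OF zk] by auto
qed

lemma Ln_one_minus_sums: "cmod z < 1 \<Longrightarrow> (\<lambda>n. - (z ^ n) / of_nat n) sums Ln (1 - z)"
  using Ln_series'[of "- z"] by simp

lemma Ln_one_minus_power_sums:
  assumes k: "0 < k" and z: "cmod z < 1"
  shows "(\<lambda>n. if k dvd n then - (of_nat k / of_nat n) * z ^ n else 0) sums Ln (1 - z ^ k)"
proof -
  have "cmod (z ^ k) < 1" using k z by (simp add: norm_power power_less_one_iff)
  then have "(\<lambda>m. - ((z ^ k) ^ m) / of_nat m) sums Ln (1 - z ^ k)" by (rule Ln_one_minus_sums)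
  also have "(\<lambda>m. - ((z ^ k) ^ m) / of_nat m)
      = (\<lambda>m. if k dvd (k * m) then - (of_nat k / of_nat (k * m)) * z ^ (k * m) else 0)"
    using k by (simp add: power_mult fun_eq_iff)
  finally show ?thesis
    by (subst (asm) sums_mono_reindex) (use k in \<open>auto simp: strict_mono_def dvd_def\<close>)
qed

text \<open>Multiplying the power series by \<open>1 - z\<close> replaces its coefficients by their differences
  \<open>1/n - k/n [k dvd n]\<close>, which are the coefficients of \<open>Ln (1 - z\<^sup>k) - Ln (1 - z)\<close>.\<close>

lemma h_fun_sums:
  assumes k: "0 < k" and z: "z \<in> ball 0 1"
  shows "(\<lambda>n. of_real (h_coeff k n) * z ^ n) sums h_fun k z"
proof -
  have z': "cmod z < 1" using z by simp
  let ?L = "Ln ((\<Sum>i<k. z ^ i) / of_nat k)"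
  let ?a = "\<lambda>n. of_real (h_coeff k n) * z ^ n"
  have "summable ?a"
    using h_coeff_square_summable[OF k]
    by (intro square_summable_imp_power_series_summable z') simp
  then obtain s where s: "?a sums s" by (auto simp: summable_def)
  have a0: "?a 0 = - of_real (ln (real k))" by (simp add: h_coeff_def harm_def)
  have "(\<lambda>n. ?a (Suc n)) sums (s - ?a 0)"
    by (subst sums_Suc_iff) (use s in simp)
  moreover have "(\<lambda>n. z * ?a n) sums (z * s)" using s by (rule sums_mult)
  ultimately have lhs: "(\<lambda>n. ?a (Suc n) - z * ?a n) sums (s - ?a 0 - z * s)" by (rule sums_diff)
  let ?c = "\<lambda>n. (if k dvd n then - (of_nat k / of_nat n) * z ^ n else 0) - - (z ^ n) / of_nat n"
  have "?c sums (Ln (1 - z ^ k) - Ln (1 - z))"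
    by (intro sums_diff Ln_one_minus_power_sums Ln_one_minus_sums k z')
  then have rhs: "(\<lambda>n. ?c (Suc n)) sums (Ln (1 - z ^ k) - Ln (1 - z))"
    by (subst sums_Suc_iff) simp
  have "?a (Suc n) - z * ?a n = ?c (Suc n)" for n
  proof -
    have "h_coeff k (Suc n) - h_coeff k n
        = inverse (real (Suc n)) - (if k dvd Suc n then real k / real (Suc n) else 0)"
    proof (cases "k dvd Suc n")
      case True
      then have "Suc n div k = Suc (n div k)" by (simp add: div_Suc dvd_eq_mod_eq_0)
      moreover have "real (Suc n) = real k * real (Suc n div k)"
        using True by (metis dvd_mult_div_cancel of_nat_mult)
      then have "real k / real (Suc n) = inverse (real (Suc n div k))"
        using k by (simp add: inverse_eq_divide)
      ultimately show ?thesis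
        using True by (simp add: h_coeff_def harm_Suc)
    next
      case False
      then show ?thesis by (simp add: h_coeff_def harm_Suc div_Suc dvd_eq_mod_eq_0)
    qed
    moreover have "?a (Suc n) - z * ?a n = of_real (h_coeff k (Suc n) - h_coeff k n) * z ^ Suc n"
      by (simp add: algebra_simps)
    moreover have "?c (Suc n) = of_real (inverse (real (Suc n))
        - (if k dvd Suc n then real k / real (Suc n) else 0)) * z ^ Suc n"
      by (simp add: algebra_simps divide_inverse del: of_nat_Suc)
    ultimately show ?thesis by (simp only:)
  qed
  with lhs rhs have "s - ?a 0 - z * s = Ln (1 - z ^ k) - Ln (1 - z)"
    by (simp add: sums_unique2)
  then have "(1 - z) * s = ?L"
    unfolding Ln_geometric_mean[OF k z'] a0 by (simp add: algebra_simps)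
  moreover have "1 - z \<noteq> 0" using z' by auto
  ultimately have "s = h_fun k z" using z by (simp add: h_fun_def field_simps)
  then show ?thesis using s by simp
qed

proposition h_fun_hardy2:
  assumes "0 < k" shows "h_fun k \<in> hardy2"
proof -
  note h = hol_disc_power_series[OF h_fun_sums[OF assms]]
  have "h_fun k \<in> hol_disc" by (rule h(1)) (auto simp: h_fun_def)
  moreover have "taylor_coeff (h_fun k) n = of_real (h_coeff k n)" for n
    by (rule h(2)) (auto simp: h_fun_def)
  ultimately show ?thesis
    using h_coeff_square_summable[OF assms] by (simp add: hardy2_def)
qed

section \<open>Density and annihilators\<close>

lemma N_space_subset_hardy2: "N_space \<subseteq> hardy2"
  unfolding N_space_def
  by (rule fun_space.span_minimal[OF _ hardy2_subspace]) (auto intro: h_fun_hardy2)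

text \<open>This contains \<open>X\<^sup>* \<subseteq> H\<^sup>2\<close> and the agreement of the Cauchy pairing with the inner product: both
  follow once the values at monomials are known, since these determine a bounded functional on
  \<open>H\<^sup>2\<close>.\<close>

lemma cauchy_dual_representation:
  assumes H: "hardy2 \<subseteq> topspace X" "continuous_map hardy2_topology X (\<lambda>f. f)"
    and \<phi>: "continuous_linear_functional X \<phi>" and g: "g \<in> hol_disc"
    and pair: "\<And>f. f \<in> topspace X \<Longrightarrow> has_cauchy_pairing f g (\<phi> f)"
  shows "g \<in> hardy2" and "f \<in> hardy2 \<Longrightarrow> \<phi> f = hardy2_inner f g"
proof -
  have coeff: "\<phi> (disc_monomial n) = cnj (taylor_coeff g n)" for n
  proof (rule has_cauchy_pairing_unique)
    show "has_cauchy_pairing (disc_monomial n) g (\<phi> (disc_monomial n))"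
      using pair disc_monomial_hardy2 H(1) by blast
    show "has_cauchy_pairing (disc_monomial n) g (cnj (taylor_coeff g n))"
      using g by (rule cauchy_pairing_monomial)
  qed
  show "g \<in> hardy2"
    using hardy2_functional_coefficients(1)[OF H \<phi>] g by (simp add: coeff hardy2_def)
  show "\<phi> f = hardy2_inner f g" if "f \<in> hardy2"
    using hardy2_functional_coefficients(2)[OF H \<phi> that]
    by (simp add: coeff hardy2_inner_def sums_unique)
qed

lemma continuous_functional_vanishing_on_dense:
  assumes \<phi>: "continuous_linear_functional X \<phi>" and zero: "\<And>f. f \<in> M \<Longrightarrow> \<phi> f = 0"
    and f: "f \<in> X closure_of M"
  shows "\<phi> f = 0"
proof -
  have "\<phi> ` (X closure_of M) \<subseteq> euclidean closure_of (\<phi> ` M)"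
    using \<phi> by (intro continuous_map_image_closure_subset) (simp add: continuous_linear_functional_def)
  also have "\<dots> \<subseteq> euclidean closure_of {0}" using zero by (intro closure_of_mono) auto
  also have "\<dots> = {0}" by simp
  finally show ?thesis using f by auto
qed

theorem proposition9:
  fixes X :: "(complex \<Rightarrow> complex) topology"
    and X_dual :: "(complex \<Rightarrow> complex) set"
  assumes "topological_linear_space X"
    and "hardy2 \<subseteq> topspace X" and "continuous_map hardy2_topology X (\<lambda>f. f)"
    and "topspace X \<subseteq> hol_disc" and "continuous_map X hol_topology (\<lambda>f. f)"
    and "cauchy_dual X X_dual"
  shows "(X closure_of N_space = topspace X \<longrightarrow> N_perp \<inter> X_dual = {0}) \<and>
         (frechet_space X \<and> N_perp \<inter> X_dual = {0} \<longrightarrow> X closure_of N_space = topspace X)"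
proof (intro conjI impI)
  note X = assms(1) and H = assms(2,3) and dual = assms(6)[unfolded cauchy_dual_def]
  have dual_hol: "g \<in> hol_disc" if "g \<in> X_dual" for g using dual that by blast
  have represented: "continuous_linear_functional X \<phi> \<longleftrightarrow>
      (\<exists>g\<in>X_dual. \<forall>f\<in>topspace X. has_cauchy_pairing f g (\<phi> f))" for \<phi>
    using dual by blast
  {
    assume dense: "X closure_of N_space = topspace X"
    have "g = 0" if g: "g \<in> N_perp" "g \<in> X_dual" for g
    proof -
      have "\<forall>f\<in>topspace X. \<exists>c. has_cauchy_pairing f g c" using dual g(2) by blast
      then obtain \<phi> where pair: "\<And>f. f \<in> topspace X \<Longrightarrow> has_cauchy_pairing f g (\<phi> f)"
        by metis
      then have \<phi>: "continuous_linear_functional X \<phi>" using represented g(2) by blast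
      have "\<phi> f = 0" if "f \<in> N_space" for f
        using cauchy_dual_representation(2)[OF H \<phi> dual_hol[OF g(2)] pair] that g(1)
          N_space_subset_hardy2 by (auto simp: N_perp_def)
      then have vanish: "\<phi> f = 0" if "f \<in> topspace X" for f
        using continuous_functional_vanishing_on_dense[OF \<phi>] that dense by blast
      have "taylor_coeff g n = 0" for n
      proof -
        have "disc_monomial n \<in> topspace X" using disc_monomial_hardy2 H(1) by blast
        then have "has_cauchy_pairing (disc_monomial n) g 0" using pair vanish by metis
        then have "0 = cnj (taylor_coeff g n)"
          using has_cauchy_pairing_unique cauchy_pairing_monomial[OF dual_hol[OF g(2)]] by blast
        then show ?thesis by simp
      qed
      then show ?thesis
        using dual_hol[OF g(2)] zero_hardy2 by (intro hol_disc_eqI) (auto simp: hardy2_def)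
    qed
    moreover have "0 \<in> N_perp" using zero_hardy2 by (simp add: N_perp_def hardy2_inner_def)
    moreover have "0 \<in> X_dual" using dual fun_space.subspace_0 by blast
    ultimately show "N_perp \<inter> X_dual = {0}" by blast
  }
  {
    assume A: "frechet_space X \<and> N_perp \<inter> X_dual = {0}"
    have N: "fun_space.subspace N_space" "N_space \<subseteq> topspace X"
      using N_space_subset_hardy2 H(1) by (auto simp: N_space_def fun_space.subspace_span)
    show "X closure_of N_space = topspace X"
    proof (rule ccontr)
      assume "X closure_of N_space \<noteq> topspace X"
      then obtain f0 where f0: "f0 \<in> topspace X" "f0 \<notin> X closure_of N_space"
        using closure_of_subset_topspace[of X N_space] by blast
      have "locally_convex X" using A by (simp add: frechet_space_def)
      then obtain \<phi> where \<phi>: "continuous_linear_functional X \<phi>"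
        and vanish: "\<And>f. f \<in> N_space \<Longrightarrow> \<phi> f = 0" and nz: "\<phi> f0 \<noteq> 0"
        using hahn_banach_separation[OF X _ N f0] by blast
      obtain g where g: "g \<in> X_dual" and pair: "\<And>f. f \<in> topspace X \<Longrightarrow> has_cauchy_pairing f g (\<phi> f)"
        using represented \<phi> by blast
      note rep = cauchy_dual_representation[OF H \<phi> dual_hol[OF g] pair]
      have "g \<in> N_perp"
        using rep vanish N_space_subset_hardy2 by (auto simp: N_perp_def subset_iff)
      then have "g = 0" using A g by blast
      then have "has_cauchy_pairing f0 g 0"
        by (simp add: has_cauchy_pairing_def circle_mean_def)
      then show False using has_cauchy_pairing_unique pair[OF f0(1)] nz by blast
    qed
  }
qed

end
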